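(* Let $n\geq 3$, $0<\alpha<1$, and let $\Omega\subset\mathbb{R}^n$ be a bounded domain of class $C^{2+\alpha}$, with hyperbolic radius $v_\Omega$. Let $d(x)$ be the distance from $x$ to $\partial\Omega$, let $w:=(v_\Omega-2d)/d^2$, and let $$M_w(f):=\frac{n d^2}{2(2+dw)}\left[2f\,\nabla d\cdot\nabla w+d\,\nabla w\cdot\nabla f\right]-2d f\,\Delta d .$$ Then $d\nabla w$ and $M_w(w)/d$ are bounded near $\partial\Omega$, i.e. bounded on $\{x\in\Omega: 0<d(x)<\delta\}$ for some $\delta>0$.
   Context: The hyperbolic radius is $v_\Omega=u_\Omega^{-2/(n-2)}$, where the maximal solution $u_\Omega$ is the positive, smooth (in the interior of $\Omega$) solution of $-\Delta u+n(n-2)u^{\frac{n+2}{n-2}}=0$ in $\Omega$ which dominates all classical solutions; it is known to exist, and it is the limit as $m\to\infty$ of the increasing sequence $(u_m)_{m\ge1}$ of solutions of this equation equal to $m$ on $\partial\Omega$. The distance function $d$ is of class $C^{2+\alpha}$ near $\partial\Omega$. Note $2+dw=v_\Omega/d>0$ in $\Omega$. *)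

theory Defs
  imports "HOL-Analysis.Analysis"
begin

definition partial_deriv :: "'n::finite \<Rightarrow> (real^'n \<Rightarrow> real) \<Rightarrow> real^'n \<Rightarrow> real" where
  "partial_deriv i f x = frechet_derivative f (at x) (axis i 1)"

definition grad :: "(real^'n::finite \<Rightarrow> real) \<Rightarrow> real^'n \<Rightarrow> real^'n" where
  "grad f x = (\<chi> i. partial_deriv i f x)"

definition laplacian :: "(real^'n::finite \<Rightarrow> real) \<Rightarrow> real^'n \<Rightarrow> real" where
  "laplacian f x = (\<Sum>i\<in>UNIV. partial_deriv i (partial_deriv i f) x)"

text \<open>
  \<open>Ck k S f\<close>: \<open>f\<close> is of class \<open>C\<^sup>k\<close> on \<open>S\<close>.
  \<open>Ck_holder k \<alpha> S f\<close>: moreover the partial derivatives of order \<open>k\<close> are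
  Hoelder continuous on \<open>S\<close> with exponent \<open>\<alpha>\<close>. Both are meant for open \<open>S\<close>.
\<close>

primrec Ck :: "nat \<Rightarrow> (real^'n::finite) set \<Rightarrow> (real^'n \<Rightarrow> real) \<Rightarrow> bool" where
  "Ck 0 S f \<longleftrightarrow> continuous_on S f"
| "Ck (Suc k) S f \<longleftrightarrow>
    (\<forall>x\<in>S. f differentiable (at x)) \<and> (\<forall>i. Ck k S (partial_deriv i f))"

primrec Ck_holder ::
    "nat \<Rightarrow> real \<Rightarrow> (real^'n::finite) set \<Rightarrow> (real^'n \<Rightarrow> real) \<Rightarrow> bool" where
  "Ck_holder 0 \<alpha> S f \<longleftrightarrow>
    (\<exists>C. \<forall>x\<in>S. \<forall>y\<in>S. \<bar>f x - f y\<bar> \<le> C * dist x y powr \<alpha>)"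
| "Ck_holder (Suc k) \<alpha> S f \<longleftrightarrow>
    (\<forall>x\<in>S. f differentiable (at x)) \<and> (\<forall>i. Ck_holder k \<alpha> S (partial_deriv i f))"

text \<open>
  A bounded domain of class \<open>C\<^sup>k\<^sup>+\<^sup>\<alpha>\<close>: near each boundary point \<open>p\<close>, in suitable
  Cartesian coordinates \<open>y = T (x - p)\<close>, the domain is the region above the graph of a
  \<open>C\<^sup>k\<^sup>+\<^sup>\<alpha>\<close> function of the coordinates other than \<open>y $ j\<close>. A function of these
  \<open>n - 1\<close> coordinates is encoded as a function on \<open>real^'n\<close> invariant under
  translations along the \<open>j\<close>-th axis.
\<close>

definition bounded_Ck_holder_domain ::
    "nat \<Rightarrow> real \<Rightarrow> (real^'n::finite) set \<Rightarrow> bool" where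
  "bounded_Ck_holder_domain k \<alpha> \<Omega> \<longleftrightarrow>
    open \<Omega> \<and> connected \<Omega> \<and> \<Omega> \<noteq> {} \<and> bounded \<Omega> \<and>
    (\<forall>p\<in>frontier \<Omega>. \<exists>r>0. \<exists>(T :: real^'n \<Rightarrow> real^'n) j (g :: real^'n \<Rightarrow> real).
       orthogonal_transformation T \<and>
       (\<forall>y t. g (y + axis j t) = g y) \<and>
       Ck_holder k \<alpha> (ball 0 r) g \<and>
       \<Omega> \<inter> ball p r = {x \<in> ball p r. g (T (x - p)) < T (x - p) $ j})"

text \<open>
  Classical (that is, \<open>C\<^sup>2\<close>) solutions of \<open>- \<Delta>u + n (n - 2) u\<^sup>(\<^sup>n\<^sup>+\<^sup>2\<^sup>)\<^sup>/\<^sup>(\<^sup>n\<^sup>-\<^sup>2\<^sup>) = 0\<close>.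
  They are taken to be positive, so that the fractional power makes sense.
\<close>

definition classical_solution ::
    "(real^'n::finite) set \<Rightarrow> (real^'n \<Rightarrow> real) \<Rightarrow> bool" where
  "classical_solution \<Omega> u \<longleftrightarrow>
    Ck 2 \<Omega> u \<and> (\<forall>x\<in>\<Omega>. 0 < u x) \<and>
    (\<forall>x\<in>\<Omega>. - laplacian u x + real CARD('n) * (real CARD('n) - 2) *
        u x powr ((real CARD('n) + 2) / (real CARD('n) - 2)) = 0)"

definition maximal_solution ::
    "(real^'n::finite) set \<Rightarrow> (real^'n \<Rightarrow> real) \<Rightarrow> bool" where
  "maximal_solution \<Omega> u \<longleftrightarrow>
    classical_solution \<Omega> u \<and> (\<forall>k. Ck k \<Omega> u) \<and>
    (\<forall>u'. classical_solution \<Omega> u' \<longrightarrow> (\<forall>x\<in>\<Omega>. u' x \<le> u x))"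

definition hyperbolic_radius :: "(real^'n::finite \<Rightarrow> real) \<Rightarrow> real^'n \<Rightarrow> real" where
  "hyperbolic_radius u x = u x powr (- 2 / (real CARD('n) - 2))"

definition boundary_dist :: "(real^'n::finite) set \<Rightarrow> real^'n \<Rightarrow> real" where
  "boundary_dist \<Omega> x = infdist x (frontier \<Omega>)"

text \<open>The operator \<open>M\<^sub>w\<close>, with the distance function \<open>d\<close> as an explicit argument.\<close>

definition M_op :: "(real^'n::finite \<Rightarrow> real) \<Rightarrow> (real^'n \<Rightarrow> real) \<Rightarrow>
    (real^'n \<Rightarrow> real) \<Rightarrow> real^'n \<Rightarrow> real" where
  "M_op d w f x =
    real CARD('n) * (d x)\<^sup>2 / (2 * (2 + d x * w x)) *
      (2 * f x * (grad d x \<bullet> grad w x) + d x * (grad w x \<bullet> grad f x))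
    - 2 * d x * f x * laplacian d x"

definition bounded_near_boundary ::
    "(real^'n::finite) set \<Rightarrow> (real^'n \<Rightarrow> 'b::real_normed_vector) \<Rightarrow> bool" where
  "bounded_near_boundary \<Omega> F \<longleftrightarrow>
    (\<exists>\<delta>>0. bounded (F ` {x \<in> \<Omega>. 0 < boundary_dist \<Omega> x \<and> boundary_dist \<Omega> x < \<delta>}))"

end

theory Submission
  imports Defs
begin

text \<open>
  Write \<open>\<nabla>w = (\<nabla>v - 2 \<nabla>d) / d\<^sup>2 - 2 (v - 2 d) \<nabla>d / d\<^sup>3\<close>. Since \<open>2 + d w = v / d\<close>, the quotient
  \<open>M\<^sub>w(w) / d\<close> is a combination of \<open>w\<close>, \<open>d \<nabla>w\<close>, \<open>\<nabla>d\<close>, \<open>\<Delta>d\<close> and \<open>d / v\<close>. Hence the theorem follows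
  from four estimates in a collar \<open>0 < d < \<delta>\<close>:
  \<open>\<bar>v - 2 d\<bar> \<le> C d\<^sup>2\<close>, \<open>v \<ge> d\<close>, \<open>\<bar>\<nabla>v - 2 \<nabla>d\<bar> \<le> C d\<close> and \<open>\<bar>\<Delta>d\<bar> \<le> C\<close>.

  \<^bold>\<open>Geometry.\<close> A \<open>C\<^sup>2\<^sup>+\<^sup>\<alpha>\<close> boundary has a Lipschitz and differentiable unit normal, so by compactness
  there is one radius \<open>s\<close> for which an interior and an exterior ball of radius \<open>s\<close> touch the boundary at
  each of its points (\<open>uniform_normal_field\<close>). Near the boundary \<open>d\<close> is squeezed between the distances
  to the two spheres, which gives \<open>\<nabla>d = \<nu>\<close>, the normal at the foot point
  (\<open>foot_point_and_gradient\<close>). The foot point is found by inverting \<open>(p, t) \<mapsto> p + t \<nu>(p)\<close>; as \<open>\<nu>\<close> has Lipschitz constant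
  at most \<open>1 / (2 s)\<close>, the linearised equation is solvable for \<open>t < s / 2\<close>, so \<open>\<nabla>d\<close> is differentiable
  with a bounded derivative (\<open>grad_boundary_dist_differentiable\<close>).

  \<^bold>\<open>Comparison.\<close> The equation has explicit solutions in a ball and in the exterior of a ball, with
  hyperbolic radii \<open>\<plusminus> (s\<^sup>2 - \<bar>x - c\<bar>\<^sup>2) / s\<close>. The exterior one lies below \<open>u\<close> because \<open>u\<close> is maximal
  (\<open>hyperbolic_radius_le_exterior\<close>); the interior one lies above \<open>u\<close> because it blows up at the sphere
  (\<open>hyperbolic_radius_ge_interior\<close>). The two model radii differ by \<open>2 \<bar>x - p\<bar>\<^sup>2 / s\<close>, where \<open>p\<close> is
  the point of contact, which yields the first two estimates.

  \<^bold>\<open>Gradient.\<close> On a cube of size comparable to \<open>d(x)\<close> around \<open>x\<close>, the difference of \<open>u\<close> and the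
  interior model solution is small and has a small Laplacian. Brandt's elementary interior estimate
  \<open>\<bar>\<partial>\<^sub>k z\<bar> \<le> n sup \<bar>z\<bar> / R + R sup \<bar>\<Delta>z\<bar> / 2\<close> (\<open>gradient_estimate\<close>) then bounds the difference of the
  gradients, and the gradient of the model radius is explicit
  (\<open>hyperbolic_radius_collar_estimates\<close>).
\<close>

section \<open>Partial derivatives and gradients\<close>

lemma partial_deriv_eq:
  assumes "(f has_derivative f') (at x)"
  shows "partial_deriv i f x = f' (axis i 1)"
  using frechet_derivative_at[OF assms] by (simp add: partial_deriv_def)

lemma grad_eq:
  fixes G :: "real^'n::finite"
  assumes "(f has_derivative (\<lambda>h. G \<bullet> h)) (at x)"
  shows "grad f x = G"
  by (simp add: grad_def vec_eq_iff partial_deriv_eq[OF assms] inner_axis)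

text \<open>
  Only on the open set \<open>S\<close> is \<open>partial_deriv i f\<close> known to be a component of \<open>G\<close>; differentiability
  at a point depends on a neighbourhood alone, so this suffices.
\<close>

lemma has_derivative_partial_deriv:
  fixes f :: "real^'n::finite \<Rightarrow> real"
  assumes "open S" "x \<in> S" and f: "\<And>x. x \<in> S \<Longrightarrow> (f has_derivative (\<lambda>h. G x \<bullet> h)) (at x)"
    and G: "(G has_derivative G') (at x)"
  shows "(partial_deriv i f has_derivative (\<lambda>h. G' h $ i)) (at x)"
proof (rule has_derivative_transform_within_open[OF _ assms(1,2)])
  show "((\<lambda>x. G x $ i) has_derivative (\<lambda>h. G' h $ i)) (at x)"
    using bounded_linear.has_derivative[OF bounded_linear_vec_nth G] .
  show "G y $ i = partial_deriv i f y" if "y \<in> S" for y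
    by (simp add: partial_deriv_eq[OF f[OF that]] inner_axis)
qed

lemma laplacian_eq:
  fixes f :: "real^'n::finite \<Rightarrow> real"
  assumes "open S" "x \<in> S" and f: "\<And>x. x \<in> S \<Longrightarrow> (f has_derivative (\<lambda>h. G x \<bullet> h)) (at x)"
    and G: "(G has_derivative G') (at x)"
  shows "laplacian f x = (\<Sum>i\<in>UNIV. G' (axis i 1) $ i)"
  unfolding laplacian_def by (simp add: partial_deriv_eq[OF has_derivative_partial_deriv[OF assms]])

lemma Ck_2I:
  fixes f :: "real^'n::finite \<Rightarrow> real"
  assumes "open S" and f: "\<And>x. x \<in> S \<Longrightarrow> (f has_derivative (\<lambda>h. G x \<bullet> h)) (at x)"
    and G: "\<And>x. x \<in> S \<Longrightarrow> (G has_derivative G' x) (at x)"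
    and cont: "\<And>h. continuous_on S (\<lambda>x. G' x h)"
  shows "Ck 2 S f"
proof -
  have d: "(partial_deriv i f has_derivative (\<lambda>h. G' x h $ i)) (at x)" if "x \<in> S" for x i
    by (rule has_derivative_partial_deriv[OF \<open>open S\<close> that f G[OF that]])
  have "continuous_on S (partial_deriv j (partial_deriv i f))" for i j
  proof -
    have "partial_deriv j (partial_deriv i f) x = G' x (axis j 1) $ i" if "x \<in> S" for x
      by (rule partial_deriv_eq[OF d]) (use that in auto)
    moreover have "continuous_on S (\<lambda>x. G' x (axis j 1) $ i)"
      by (intro continuous_intros cont)
    ultimately show ?thesis by (simp cong: continuous_on_cong)
  qed
  moreover have "f differentiable at x" "partial_deriv i f differentiable at x" if "x \<in> S" for x i
    using f[OF that] d[OF that, of i] by (auto simp: differentiable_def)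
  ultimately show ?thesis by (simp add: numeral_2_eq_2)
qed


lemma has_derivative_grad:
  fixes f :: "real^'n::finite \<Rightarrow> real"
  assumes "f differentiable (at x)"
  shows "(f has_derivative (\<lambda>h. grad f x \<bullet> h)) (at x)"
proof -
  let ?L = "frechet_derivative f (at x)"
  have lin: "linear ?L" by (rule linear_frechet_derivative[OF assms])
  have "?L h = grad f x \<bullet> h" for h
  proof -
    have "?L h = ?L (\<Sum>i\<in>UNIV. h $ i *\<^sub>R axis i 1)"
      using basis_expansion[of h] by (simp add: scalar_mult_eq_scaleR)
    also have "\<dots> = (\<Sum>i\<in>UNIV. h $ i * ?L (axis i 1))"
      by (simp add: linear_sum[OF lin] linear_cmul[OF lin])
    finally show ?thesis
      by (simp add: grad_def partial_deriv_def inner_vec_def mult.commute)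
  qed
  then have "?L = (\<lambda>h. grad f x \<bullet> h)" by (simp add: fun_eq_iff)
  moreover have "(f has_derivative ?L) (at x)" using assms frechet_derivative_works by blast
  ultimately show ?thesis by simp
qed


section \<open>Brandt's interior gradient estimate\<close>

text \<open>
  First and pure second derivatives along the coordinate axes. The maximum principle only looks at
  these, and in this form they can be computed for differences, for reflected functions and for
  explicit barriers without any multivariate chain rule.
\<close>

definition line_partials ::
    "(real^'n::finite) set \<Rightarrow> (real^'n \<Rightarrow> real) \<Rightarrow> ('n \<Rightarrow> real^'n \<Rightarrow> real) \<Rightarrow>
      ('n \<Rightarrow> real^'n \<Rightarrow> real) \<Rightarrow> bool" where
  "line_partials S f D H \<longleftrightarrow>
    (\<forall>x\<in>S. \<forall>i.
      ((\<lambda>t. f (x + t *\<^sub>R axis i 1)) has_real_derivative D i x) (at 0) \<and>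
      ((\<lambda>t. D i (x + t *\<^sub>R axis i 1)) has_real_derivative H i x) (at 0))"

lemma line_partials_shift:
  assumes "line_partials S f D H" "x + t *\<^sub>R axis i 1 \<in> S"
  shows "((\<lambda>t. f (x + t *\<^sub>R axis i 1)) has_real_derivative D i (x + t *\<^sub>R axis i 1)) (at t)"
proof -
  have eq: "(x + t *\<^sub>R axis i 1) + r *\<^sub>R axis i 1 = x + (r + t) *\<^sub>R axis i (1::real)" for r
    by (simp add: algebra_simps)
  have "((\<lambda>r. f (x + (r + t) *\<^sub>R axis i 1)) has_real_derivative D i (x + t *\<^sub>R axis i 1)) (at 0)"
    using assms unfolding line_partials_def eq[symmetric] by blast
  then show ?thesis
    using DERIV_shift[of "\<lambda>t. f (x + t *\<^sub>R axis i 1)" _ 0 t] by simp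
qed

lemma line_partials_diff:
  assumes "line_partials S f D H" "line_partials S f' D' H'"
  shows "line_partials S (\<lambda>x. f x - f' x) (\<lambda>i x. D i x - D' i x) (\<lambda>i x. H i x - H' i x)"
  using assms unfolding line_partials_def by (auto intro!: derivative_intros)

lemma line_partials_cmult:
  assumes "line_partials S f D H"
  shows "line_partials S (\<lambda>x. c * f x) (\<lambda>i x. c * D i x) (\<lambda>i x. c * H i x)"
  using assms unfolding line_partials_def by (auto intro!: DERIV_cmult)

lemma line_partials_subset:
  assumes "line_partials S f D H" "S' \<subseteq> S"
  shows "line_partials S' f D H"
  using assms unfolding line_partials_def by blast

lemma DERIV_along_axis:
  fixes g :: "real^'n::finite \<Rightarrow> real"
  assumes "g differentiable (at x)"
  shows "((\<lambda>t. g (x + t *\<^sub>R axis i 1)) has_real_derivative partial_deriv i g x) (at 0)"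
proof -
  have g: "(g has_derivative frechet_derivative g (at x)) (at x)"
    using assms frechet_derivative_works by blast
  have "((\<lambda>t. g (x + t *\<^sub>R axis i 1)) has_derivative
      (\<lambda>t. frechet_derivative g (at x) (t *\<^sub>R axis i 1))) (at 0)"
    by (rule has_derivative_compose[of "\<lambda>t. x + t *\<^sub>R axis i 1"])
      (auto intro!: derivative_eq_intros simp: g)
  moreover have "frechet_derivative g (at x) (t *\<^sub>R axis i 1) = t * partial_deriv i g x" for t
    using linear_frechet_derivative[OF assms] by (simp add: linear_cmul partial_deriv_def)
  ultimately show ?thesis
    by (simp add: has_field_derivative_def mult_commute_abs)
qed

lemma line_partials_Ck_2:
  assumes "Ck 2 S f"
  shows "line_partials S f (\<lambda>i. partial_deriv i f) (\<lambda>i. partial_deriv i (partial_deriv i f))"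
  using assms unfolding line_partials_def
  by (auto simp: numeral_2_eq_2 intro!: DERIV_along_axis)

lemma second_derivative_nonpos_at_max:
  fixes h h' :: "real \<Rightarrow> real"
  assumes "e > 0" and h: "\<And>t. \<bar>t\<bar> < e \<Longrightarrow> (h has_real_derivative h' t) (at t)"
    and h': "(h' has_real_derivative c) (at 0)"
    and max: "\<And>t. \<bar>t\<bar> < e \<Longrightarrow> h t \<le> h 0"
  shows "c \<le> 0"
proof (rule ccontr)
  assume "\<not> c \<le> 0"
  have h0: "h' 0 = 0"
    using DERIV_local_max[of h "h' 0" 0 e] h max \<open>e > 0\<close> by auto
  obtain r where r: "r > 0" "\<And>t. 0 < t \<Longrightarrow> t < r \<Longrightarrow> h' 0 < h' (0 + t)"
    using DERIV_pos_inc_right[OF h'] \<open>\<not> c \<le> 0\<close> by auto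
  define t where "t = min r e / 2"
  have t: "0 < t" "t < r" "t < e" using r \<open>e > 0\<close> by (auto simp: t_def)
  obtain \<xi> where "0 < \<xi>" "\<xi> < t" "h t - h 0 = (t - 0) * h' \<xi>"
    using MVT2[of 0 t h h'] t h by auto
  moreover have "h' \<xi> > 0" using r(2)[of \<xi>] calculation t h0 by auto
  ultimately have "h t - h 0 > 0" using t by simp
  then show False using max[of t] t by auto
qed

lemma line_partials_nonpos_at_max:
  fixes x :: "real^'n::finite"
  assumes "open S" "x \<in> S" "line_partials S f D H" "\<And>y. y \<in> S \<Longrightarrow> f y \<le> f x"
  shows "H i x \<le> 0"
proof -
  obtain e where e: "e > 0" "ball x e \<subseteq> S" using assms openE by blast
  have S: "x + t *\<^sub>R axis i 1 \<in> S" if "\<bar>t\<bar> < e" for t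
    using e that by (auto simp: subset_eq dist_norm norm_axis_1)
  show ?thesis
  proof (rule second_derivative_nonpos_at_max[OF \<open>e > 0\<close>])
    show "((\<lambda>t. f (x + t *\<^sub>R axis i 1)) has_real_derivative D i (x + t *\<^sub>R axis i 1)) (at t)"
      if "\<bar>t\<bar> < e" for t
      by (rule line_partials_shift[OF assms(3) S[OF that]])
    show "((\<lambda>t. D i (x + t *\<^sub>R axis i 1)) has_real_derivative H i x) (at 0)"
      using assms unfolding line_partials_def by blast
  qed (use assms(4) S in auto)
qed

text \<open>
  Reflection in the hyperplane through \<open>x0\<close> orthogonal to the \<open>k\<close>-th axis.
\<close>

definition reflect :: "'n::finite \<Rightarrow> real^'n \<Rightarrow> real^'n \<Rightarrow> real^'n" where
  "reflect k x0 x = x - (2 * (x $ k - x0 $ k)) *\<^sub>R axis k 1"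

lemma reflect_nth: "reflect k x0 x $ i = (if i = k then 2 * x0 $ k - x $ k else x $ i)"
  by (simp add: reflect_def axis_def)

lemma reflect_line:
  "reflect k x0 (x + t *\<^sub>R axis i 1) =
    reflect k x0 x + ((if i = k then -1 else 1) * t) *\<^sub>R axis i 1"
  by (auto simp: vec_eq_iff reflect_nth axis_def)

text \<open>
  Along the axis \<open>k\<close> the reflection reverses the direction, which changes the sign of the first
  derivative but not of the second. So the Laplacian of the odd part of \<open>f\<close> is the odd part of the
  Laplacian of \<open>f\<close>.
\<close>

lemma line_partials_odd_part:
  assumes L: "line_partials S f D H" and S': "S' \<subseteq> S" "reflect k x0 ` S' \<subseteq> S"
  defines "\<sigma> \<equiv> \<lambda>i. if i = k then -1 else (1::real)"
  shows "line_partials S' (\<lambda>x. (f x - f (reflect k x0 x)) / 2)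
    (\<lambda>i x. (D i x - \<sigma> i * D i (reflect k x0 x)) / 2)
    (\<lambda>i x. (H i x - H i (reflect k x0 x)) / 2)"
  unfolding line_partials_def
proof (intro ballI allI conjI)
  fix x i assume x: "x \<in> S'"
  let ?y = "reflect k x0 x"
  have xS: "x \<in> S" "?y \<in> S" using S' x by auto
  have 1: "((\<lambda>t. f (?y + (\<sigma> i * t) *\<^sub>R axis i 1)) has_real_derivative D i ?y * \<sigma> i) (at 0)"
    by (rule DERIV_chain2[where f="\<lambda>t. f (?y + t *\<^sub>R axis i 1)" and g="\<lambda>t. \<sigma> i * t"])
      (use L xS in \<open>auto simp: line_partials_def intro!: derivative_eq_intros\<close>)
  have 2: "((\<lambda>t. D i (?y + (\<sigma> i * t) *\<^sub>R axis i 1)) has_real_derivative H i ?y * \<sigma> i) (at 0)"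
    by (rule DERIV_chain2[where f="\<lambda>t. D i (?y + t *\<^sub>R axis i 1)" and g="\<lambda>t. \<sigma> i * t"])
      (use L xS in \<open>auto simp: line_partials_def intro!: derivative_eq_intros\<close>)
  have 3: "((\<lambda>t. f (x + t *\<^sub>R axis i 1)) has_real_derivative D i x) (at 0)"
    "((\<lambda>t. D i (x + t *\<^sub>R axis i 1)) has_real_derivative H i x) (at 0)"
    using L xS unfolding line_partials_def by auto
  show "((\<lambda>t. (f (x + t *\<^sub>R axis i 1) - f (reflect k x0 (x + t *\<^sub>R axis i 1))) / 2)
      has_real_derivative (D i x - \<sigma> i * D i ?y) / 2) (at 0)"
    unfolding reflect_line using DERIV_cdivide[OF DERIV_diff[OF 3(1) 1], where c=2]
    by (simp add: \<sigma>_def mult.commute)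
  have "\<sigma> i * \<sigma> i = 1" by (simp add: \<sigma>_def)
  then have "\<sigma> i * (H i ?y * \<sigma> i) = H i ?y" by (simp add: mult.left_commute)
  then show "((\<lambda>t. (D i (x + t *\<^sub>R axis i 1) - \<sigma> i * D i (reflect k x0 (x + t *\<^sub>R axis i 1))) / 2)
      has_real_derivative (H i x - H i ?y) / 2) (at 0)"
    unfolding reflect_line using DERIV_cdivide[OF DERIV_diff[OF 3(2) DERIV_cmult[OF 2, where c="\<sigma> i"]], where c=2]
    by (cases "i = k") (simp_all add: \<sigma>_def)
qed

text \<open>
  The barrier of Brandt's proof, in coordinates centred at the point of interest. Its Laplacian is
  the constant \<open>- b\<close>; on the half cube \<open>0 \<le> y\<^sub>k \<le> R\<close>, \<open>\<bar>y\<^sub>i\<bar> \<le> R\<close> it is nonnegative on the face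
  \<open>y\<^sub>k = 0\<close> and at least \<open>a\<close> on all other faces.
\<close>

definition barrier :: "'n::finite \<Rightarrow> real \<Rightarrow> real \<Rightarrow> real \<Rightarrow> real^'n \<Rightarrow> real" where
  "barrier k R a b y =
    a / R\<^sup>2 * ((norm y)\<^sup>2 - (y $ k)\<^sup>2 + y $ k * (real CARD('n) * R - (real CARD('n) - 1) * y $ k))
      + b / 2 * (y $ k * (R - y $ k))"

lemma line_partials_barrier:
  fixes x0 :: "real^'n::finite" and k :: 'n
  defines "N \<equiv> real CARD('n)"
  shows "line_partials UNIV (\<lambda>x. barrier k R a b (x - x0))
    (\<lambda>i x. a / R\<^sup>2 * (2 * (x $ i - x0 $ i) + (if i = k then N * R - 2 * N * (x $ k - x0 $ k) else 0))
      + (if i = k then b / 2 * (R - 2 * (x $ k - x0 $ k)) else 0))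
    (\<lambda>i x. a / R\<^sup>2 * (2 - (if i = k then 2 * N else 0)) - (if i = k then b else 0))"
  unfolding line_partials_def
proof (intro ballI allI conjI)
  fix x :: "real^'n" and i :: 'n
  define \<kappa> where "\<kappa> = a / R\<^sup>2"
  have n: "(norm (x + t *\<^sub>R axis i 1 - x0))\<^sup>2 = (norm (x - x0))\<^sup>2 + 2 * t * (x $ i - x0 $ i) + t\<^sup>2" for t
  proof -
    have "x + t *\<^sub>R axis i 1 - x0 = (x - x0) + t *\<^sub>R axis i 1" by simp
    then show ?thesis
      by (simp only: power2_norm_eq_inner)
        (simp add: inner_add_left inner_add_right inner_axis inner_axis' power2_eq_square distrib_left)
  qed
  show "((\<lambda>t. barrier k R a b (x + t *\<^sub>R axis i 1 - x0)) has_real_derivative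
      a / R\<^sup>2 * (2 * (x $ i - x0 $ i) + (if i = k then N * R - 2 * N * (x $ k - x0 $ k) else 0))
      + (if i = k then b / 2 * (R - 2 * (x $ k - x0 $ k)) else 0)) (at 0)"
    unfolding barrier_def n N_def[symmetric] \<kappa>_def[symmetric]
    by (cases "i = k") (auto simp: axis_def power2_eq_square algebra_simps intro!: derivative_eq_intros)
  show "((\<lambda>t. a / R\<^sup>2 * (2 * ((x + t *\<^sub>R axis i 1) $ i - x0 $ i) +
        (if i = k then N * R - 2 * N * ((x + t *\<^sub>R axis i 1) $ k - x0 $ k) else 0))
      + (if i = k then b / 2 * (R - 2 * ((x + t *\<^sub>R axis i 1) $ k - x0 $ k)) else 0))
      has_real_derivative a / R\<^sup>2 * (2 - (if i = k then 2 * N else 0)) - (if i = k then b else 0)) (at 0)"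
    unfolding \<kappa>_def[symmetric]
    by (cases "i = k") (auto simp: axis_def algebra_simps intro!: derivative_eq_intros)
qed

lemma component_square_bounds:
  fixes y :: "real^'n::finite"
  shows "i \<noteq> k \<Longrightarrow> (y $ i)\<^sup>2 \<le> (norm y)\<^sup>2 - (y $ k)\<^sup>2"
    and "(y $ k)\<^sup>2 \<le> (norm y)\<^sup>2"
proof -
  have *: "(norm y)\<^sup>2 = (\<Sum>j\<in>UNIV. (y $ j)\<^sup>2)"
    by (simp add: norm_vec_def L2_set_def sum_nonneg)
  show "(y $ k)\<^sup>2 \<le> (norm y)\<^sup>2"
    unfolding * by (rule member_le_sum) auto
  show "(y $ i)\<^sup>2 \<le> (norm y)\<^sup>2 - (y $ k)\<^sup>2" if "i \<noteq> k"
  proof -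
    have "(\<Sum>j\<in>{i,k}. (y $ j)\<^sup>2) \<le> (\<Sum>j\<in>UNIV. (y $ j)\<^sup>2)"
      by (rule sum_mono2) auto
    then show ?thesis using that * by simp
  qed
qed

text \<open>
  The odd part of \<open>z\<close> in the direction \<open>k\<close> vanishes on the symmetry hyperplane and is at most \<open>a\<close> in
  absolute value. Minus the barrier it cannot have a positive maximum on the half cube: not on the
  faces by the boundary values of the barrier, and not inside because its Laplacian is positive.
  Since both functions vanish at \<open>x0\<close>, dividing by the distance to the hyperplane compares their normal
  derivatives there, and the normal derivative of the odd part is that of \<open>z\<close>.
\<close>

lemma gradient_estimate_upper:
  fixes z :: "real^'n::finite \<Rightarrow> real"
  assumes R: "R > 0" and L: "line_partials S z D H" and cont: "continuous_on S z"
    and cube: "\<And>x. (\<And>i. \<bar>x $ i - x0 $ i\<bar> \<le> R) \<Longrightarrow> x \<in> S"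
    and a: "\<And>x. (\<And>i. \<bar>x $ i - x0 $ i\<bar> \<le> R) \<Longrightarrow> \<bar>z x\<bar> \<le> a"
    and b: "\<And>x. (\<And>i. \<bar>x $ i - x0 $ i\<bar> \<le> R) \<Longrightarrow> \<bar>\<Sum>i\<in>UNIV. H i x\<bar> < b"
  shows "D k x0 \<le> real CARD('n) * a / R + b * R / 2"
proof -
  define N where "N = real CARD('n)"
  have N: "N \<ge> 1" by (simp add: N_def Suc_le_eq)
  have a0: "a \<ge> 0" using a[of x0] R by force
  have b0: "b > 0" using b[of x0] R by force
  define Q where "Q = cbox (\<chi> i. if i = k then x0 $ k else x0 $ i - R) (\<chi> i. x0 $ i + R)"
  define G where "G = box (\<chi> i. if i = k then x0 $ k else x0 $ i - R) (\<chi> i. x0 $ i + R)"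
  have Qi: "\<bar>x $ i - x0 $ i\<bar> \<le> R" "x $ k \<ge> x0 $ k" if "x \<in> Q" for x i
  proof -
    have "(if i = k then x0 $ k else x0 $ i - R) \<le> x $ i \<and> x $ i \<le> x0 $ i + R" for i
      using that by (simp add: Q_def mem_box_cart)
    from this[of i] this[of k] R show "\<bar>x $ i - x0 $ i\<bar> \<le> R" "x $ k \<ge> x0 $ k"
      by (auto split: if_splits)
  qed
  have Qr: "\<bar>reflect k x0 x $ i - x0 $ i\<bar> \<le> R" if "x \<in> Q" for x i
    using Qi(1)[OF that, of i] Qi(1)[OF that, of k] by (auto simp: reflect_nth)
  have GQ: "G \<subseteq> Q" unfolding G_def Q_def by (rule box_subset_cbox)
  have QS: "Q \<subseteq> S" "reflect k x0 ` Q \<subseteq> S" using cube Qi Qr by blast+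
  define F where "F = (\<lambda>x. (z x - z (reflect k x0 x)) / 2 - barrier k R a b (x - x0))"
  have contF: "continuous_on Q F"
    unfolding F_def barrier_def reflect_def
    by (intro continuous_intros continuous_on_subset[OF cont QS(1)]
        continuous_on_compose2[OF cont]) (use QS(2) in \<open>auto simp: reflect_def\<close>, use R in auto)
  have x0Q: "x0 \<in> Q" using R by (simp add: Q_def mem_box_cart)
  have Fle: "F x \<le> 0" if "x \<in> Q" for x
  proof -
    obtain m where m: "m \<in> Q" "\<And>y. y \<in> Q \<Longrightarrow> F y \<le> F m"
      using continuous_attains_sup[OF _ _ contF] x0Q by (auto simp: Q_def)
    have "F m \<le> 0"
    proof (rule ccontr)
      assume pos: "\<not> F m \<le> 0"
      define y where "y = m - x0"
      have yR: "\<bar>y $ i\<bar> \<le> R" "0 \<le> y $ k" "y $ k \<le> R" for i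
        using Qi(1)[OF m(1), of i] Qi(1)[OF m(1), of k] Qi(2)[OF m(1)]
        unfolding y_def vector_minus_component by linarith+
      have odd_le: "(z m - z (reflect k x0 m)) / 2 \<le> a"
        using a[OF Qi(1)[OF m(1)]] a[OF Qr[OF m(1)]] by (auto simp: abs_if split: if_splits)
      have bar: "barrier k R a b y \<ge> a"
        if "(norm y)\<^sup>2 - (y $ k)\<^sup>2 + y $ k * (N * R - (N - 1) * y $ k) \<ge> R\<^sup>2"
      proof -
        have "a = a / R\<^sup>2 * R\<^sup>2" using R by simp
        also have "\<dots> \<le> a / R\<^sup>2 * ((norm y)\<^sup>2 - (y $ k)\<^sup>2 + y $ k * (N * R - (N - 1) * y $ k))"
          by (rule mult_left_mono[OF that]) (use a0 in auto)
        also have "\<dots> \<le> barrier k R a b y"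
          unfolding barrier_def N_def using yR b0 by simp
        finally show ?thesis .
      qed
      have Nk: "y $ k * (N * R - (N - 1) * y $ k) \<ge> 0"
      proof -
        have "(N - 1) * y $ k \<le> (N - 1) * R" using N yR by (intro mult_left_mono) auto
        then have "(N - 1) * y $ k \<le> N * R" using R by (simp add: algebra_simps)
        then show ?thesis using yR by simp
      qed
      have "m \<in> G"
      proof (rule ccontr)
        assume "m \<notin> G"
        then consider "y $ k = 0" | "y $ k = R" | i where "i \<noteq> k" "\<bar>y $ i\<bar> = R"
        proof -
          obtain i where i: "\<not> ((if i = k then x0 $ k else x0 $ i - R) < m $ i \<and> m $ i < x0 $ i + R)"
            using \<open>m \<notin> G\<close> by (auto simp: G_def mem_box_cart)
          show ?thesis
          proof (cases "i = k")
            case True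
            then have "y $ k = 0 \<or> y $ k = R" using i yR(2,3) by (auto simp: y_def)
            then show ?thesis using that by blast
          next
            case False
            then have "\<bar>y $ i\<bar> = R" using i yR(1)[of i] R by (auto simp: y_def)
            then show ?thesis using False that by blast
          qed
        qed
        then have "F m \<le> 0"
        proof cases
          case 1
          then have "reflect k x0 m = m" by (simp add: vec_eq_iff reflect_nth y_def)
          moreover have "barrier k R a b y \<ge> 0"
            using 1 a0 by (simp add: barrier_def)
          ultimately show ?thesis by (simp add: F_def y_def)
        next
          case 2
          have "barrier k R a b y \<ge> a"
            by (rule bar) (use 2 component_square_bounds(2)[of y k] in \<open>simp add: power2_eq_square algebra_simps\<close>)
          then show ?thesis using odd_le by (simp add: F_def y_def)
        next
          case (3 i)
          have "(y $ i)\<^sup>2 = R\<^sup>2" using 3 by (metis power2_abs)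
          then have "barrier k R a b y \<ge> a"
            by (intro bar) (use component_square_bounds(1)[OF 3(1), of y] Nk in linarith)
          then show ?thesis using odd_le by (simp add: F_def y_def)
        qed
        then show False using pos by simp
      qed
      have LF: "line_partials G F
        (\<lambda>i x. (D i x - (if i = k then -1 else 1) * D i (reflect k x0 x)) / 2 -
          (a / R\<^sup>2 * (2 * (x $ i - x0 $ i) + (if i = k then N * R - 2 * N * (x $ k - x0 $ k) else 0))
            + (if i = k then b / 2 * (R - 2 * (x $ k - x0 $ k)) else 0)))
        (\<lambda>i x. (H i x - H i (reflect k x0 x)) / 2 -
          (a / R\<^sup>2 * (2 - (if i = k then 2 * N else 0)) - (if i = k then b else 0)))"
        unfolding F_def N_def
        by (rule line_partials_diff[OF line_partials_odd_part[OF L]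
            line_partials_subset[OF line_partials_barrier]]) (use QS GQ in auto)
      have "(\<Sum>i\<in>UNIV. (H i m - H i (reflect k x0 m)) / 2 -
          (a / R\<^sup>2 * (2 - (if i = k then 2 * N else 0)) - (if i = k then b else 0))) \<le> 0"
        by (intro sum_nonpos line_partials_nonpos_at_max[OF _ \<open>m \<in> G\<close> LF])
          (use m GQ in \<open>auto simp: G_def open_box\<close>)
      moreover have "(\<Sum>i\<in>UNIV. (a / R\<^sup>2 * (2 - (if i = k then 2 * N else 0)) - (if i = k then b else 0))) = - b"
      proof -
        have "(\<Sum>i\<in>UNIV. 2 - (if i = k then 2 * N else 0)) = 0"
          by (simp add: sum_subtractf N_def)
        then show ?thesis
          by (simp only: sum_subtractf flip: sum_distrib_left) simp
      qed
      moreover have "(\<Sum>i\<in>UNIV. (H i m - H i (reflect k x0 m)) / 2) =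
          ((\<Sum>i\<in>UNIV. H i m) - (\<Sum>i\<in>UNIV. H i (reflect k x0 m))) / 2"
        by (simp add: sum_subtractf flip: sum_divide_distrib)
      ultimately have le: "((\<Sum>i\<in>UNIV. H i m) - (\<Sum>i\<in>UNIV. H i (reflect k x0 m))) / 2 + b \<le> 0"
        by (simp only: sum_subtractf[of "\<lambda>i. (H i m - H i (reflect k x0 m)) / 2"])
      have "\<not> (X - Y) / 2 + b \<le> 0" if "\<bar>X\<bar> < b" "\<bar>Y\<bar> < b" for X Y
        using that unfolding diff_divide_distrib by linarith
      from this[OF b[OF Qi(1)[OF m(1)]] b[OF Qr[OF m(1)]]] le show False by (rule notE)
    qed
    then show ?thesis using m that by force
  qed
  define f where "f = (\<lambda>t. (z (x0 + t *\<^sub>R axis k 1) - z (x0 + (- t) *\<^sub>R axis k 1)) / 2)"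
  have f_le: "f t \<le> t * (N * a / R + b * R / 2)" if "0 < t" "t < R" for t
  proof -
    have Q: "x0 + t *\<^sub>R axis k 1 \<in> Q"
      using that R by (auto simp: Q_def mem_box_cart axis_def)
    have "reflect k x0 (x0 + t *\<^sub>R axis k 1) = x0 + (- t) *\<^sub>R axis k 1"
      by (auto simp: vec_eq_iff reflect_nth axis_def)
    then have "f t \<le> barrier k R a b (t *\<^sub>R axis k 1)"
      using Fle[OF Q] by (simp add: F_def f_def)
    also have "\<dots> = t * (N * a / R + b * R / 2) - (a / R\<^sup>2 * (N - 1) * t\<^sup>2 + b / 2 * t\<^sup>2)"
      using R by (simp add: barrier_def N_def norm_axis_1 field_simps power2_eq_square)
    also have "\<dots> \<le> t * (N * a / R + b * R / 2)"
    proof -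
      have "0 \<le> a / R\<^sup>2 * (N - 1) * t\<^sup>2" "0 \<le> b / 2 * t\<^sup>2" using a0 b0 N by auto
      then show ?thesis by linarith
    qed
    finally show ?thesis .
  qed
  have "x0 \<in> S" using cube[of x0] R by simp
  then have d1: "((\<lambda>t. z (x0 + t *\<^sub>R axis k 1)) has_real_derivative D k x0) (at 0)"
    using L by (auto simp: line_partials_def)
  then have d2: "((\<lambda>t. z (x0 + (- t) *\<^sub>R axis k 1)) has_real_derivative D k x0 * (-1)) (at 0)"
    by (intro DERIV_chain2[where f="\<lambda>t. z (x0 + t *\<^sub>R axis k 1)" and g="\<lambda>t. - t"])
      (auto intro!: derivative_eq_intros)
  have "(f has_real_derivative D k x0) (at 0)"
    using DERIV_cdivide[OF DERIV_diff[OF d1 d2], where c=2] by (simp add: f_def)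
  then have lim: "((\<lambda>t. (f t - f 0) / t) \<longlongrightarrow> D k x0) (at_right 0)"
    unfolding has_field_derivative_iff by (auto intro: tendsto_within_subset[OF _ subset_UNIV])
  have "D k x0 \<le> N * a / R + b * R / 2"
  proof (rule tendsto_upperbound[OF lim])
    have "\<forall>\<^sub>F t in at_right 0. t \<in> {0<..<R}" using R eventually_at_right_less[of "0::real"]
      by (auto simp: eventually_at_right_field intro!: exI[of _ R])
    then show "\<forall>\<^sub>F t in at_right 0. (f t - f 0) / t \<le> N * a / R + b * R / 2"
    proof eventually_elim
      case (elim t)
      have "f t \<le> (N * a / R + b * R / 2) * t"
        using f_le[of t] elim by (metis greaterThanLessThan_iff mult.commute)
      then have "f t / t \<le> N * a / R + b * R / 2"
        using elim by (simp only: pos_divide_le_eq greaterThanLessThan_iff)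
      moreover have "f 0 = 0" by (simp add: f_def)
      ultimately show ?case by simp
    qed
  qed simp
  then show ?thesis by (simp add: N_def)
qed

lemma gradient_estimate:
  fixes z :: "real^'n::finite \<Rightarrow> real"
  assumes R: "R > 0" and L: "line_partials S z D H" and cont: "continuous_on S z"
    and cube: "\<And>x. (\<And>i. \<bar>x $ i - x0 $ i\<bar> \<le> R) \<Longrightarrow> x \<in> S"
    and a: "\<And>x. (\<And>i. \<bar>x $ i - x0 $ i\<bar> \<le> R) \<Longrightarrow> \<bar>z x\<bar> \<le> a"
    and b: "\<And>x. (\<And>i. \<bar>x $ i - x0 $ i\<bar> \<le> R) \<Longrightarrow> \<bar>\<Sum>i\<in>UNIV. H i x\<bar> < b"
  shows "\<bar>D k x0\<bar> \<le> real CARD('n) * a / R + b * R / 2"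
proof -
  have "D k x0 \<le> real CARD('n) * a / R + b * R / 2"
    by (rule gradient_estimate_upper[OF R L cont cube a b])
  moreover have "- 1 * D k x0 \<le> real CARD('n) * a / R + b * R / 2"
    by (rule gradient_estimate_upper[OF R line_partials_cmult[OF L, of "-1"] _ cube])
      (use a b in \<open>auto intro!: continuous_intros cont simp: sum_negf\<close>)
  ultimately show ?thesis by linarith
qed

section \<open>Model solutions and comparison\<close>

text \<open>
  The hyperbolic radius of the ball of radius \<open>s\<close> around \<open>c\<close> (for \<open>\<sigma> = 1\<close>) and of its exterior
  (for \<open>\<sigma> = - 1\<close>).
\<close>

definition model_radius :: "real \<Rightarrow> real \<Rightarrow> real^'n::finite \<Rightarrow> real^'n \<Rightarrow> real" where
  "model_radius \<sigma> s c x = \<sigma> * (s\<^sup>2 - (norm (x - c))\<^sup>2) / s"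

definition model_solution :: "real \<Rightarrow> real \<Rightarrow> real^'n::finite \<Rightarrow> real^'n \<Rightarrow> real" where
  "model_solution \<sigma> s c x = model_radius \<sigma> s c x powr (- ((real CARD('n) - 2) / 2))"

lemma has_derivative_model_radius:
  fixes x :: "real^'n::finite"
  shows "(model_radius \<sigma> s c has_derivative (\<lambda>h. (- (2 * \<sigma> / s) *\<^sub>R (x - c)) \<bullet> h)) (at x)"
proof -
  have "model_radius \<sigma> s c = (\<lambda>x. \<sigma> * (s\<^sup>2 - (x - c) \<bullet> (x - c)) / s)"
    by (simp add: fun_eq_iff model_radius_def power2_norm_eq_inner)
  moreover have "((\<lambda>x. \<sigma> * (s\<^sup>2 - (x - c) \<bullet> (x - c)) / s) has_derivative
      (\<lambda>h. (- (2 * \<sigma> / s) *\<^sub>R (x - c)) \<bullet> h)) (at x)"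
    unfolding divide_inverse
    by (auto intro!: derivative_eq_intros simp: fun_eq_iff inner_commute algebra_simps)
  ultimately show ?thesis by simp
qed

lemma has_derivative_powr_const:
  fixes g :: "'a::real_normed_vector \<Rightarrow> real"
  assumes "(g has_derivative g') (at x)" "g x > 0"
  shows "((\<lambda>x. g x powr r) has_derivative (\<lambda>h. g' h * (r * g x powr (r - 1)))) (at x)"
  by (rule DERIV_compose_FDERIV[OF has_real_derivative_powr[OF assms(2)] assms(1)])

text \<open>
  With \<open>V\<close> the model radius and \<open>a = (n - 2) / 2\<close>, the Laplacian of \<open>V\<^sup>-\<^sup>a\<close> is
  \<open>V\<^sup>-\<^sup>a\<^sup>-\<^sup>2 (a (a + 1) \<bar>\<nabla>V\<bar>\<^sup>2 - a V \<Delta>V)\<close>. For the quadratic function \<open>V\<close> the bracket is the constant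
  \<open>n (n - 2)\<close>, and for \<open>n \<noteq> 2\<close> the factor \<open>V\<^sup>-\<^sup>a\<^sup>-\<^sup>2\<close> is the power \<open>(n + 2) / (n - 2)\<close> of \<open>V\<^sup>-\<^sup>a\<close>.
\<close>

lemma model_solution:
  fixes c :: "real^'n::finite"
  assumes s: "s > 0" and \<sigma>: "\<sigma>\<^sup>2 = 1" and "open S"
    and pos: "\<And>x. x \<in> S \<Longrightarrow> model_radius \<sigma> s c x > 0"
  shows "classical_solution S (model_solution \<sigma> s c)"
proof -
  define V where "V = model_radius \<sigma> s c"
  define N where "N = real CARD('n)"
  define a where "a = (N - 2) / 2"
  have U: "model_solution \<sigma> s c = (\<lambda>x. V x powr (- a))"
    by (simp add: fun_eq_iff model_solution_def V_def a_def N_def)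
  note pos = pos[folded V_def]
  note dV = has_derivative_model_radius[of \<sigma> s c, folded V_def]
  define G where "G = (\<lambda>x. (2 * a * \<sigma> / s * V x powr (- a - 1)) *\<^sub>R (x - c))"
  define G' where "G' = (\<lambda>x h. (2 * a * \<sigma> / s * V x powr (- a - 1)) *\<^sub>R h +
      (4 * a * (a + 1) / s\<^sup>2 * V x powr (- a - 2) * ((x - c) \<bullet> h)) *\<^sub>R (x - c))"
  have dU: "((\<lambda>x. V x powr (- a)) has_derivative (\<lambda>h. G x \<bullet> h)) (at x)" if "x \<in> S" for x
    by (rule has_derivative_eq_rhs[OF has_derivative_powr_const[OF dV pos[OF that]]])
      (auto simp: G_def fun_eq_iff algebra_simps)
  have dG: "(G has_derivative G' x) (at x)" if "x \<in> S" for x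
  proof -
    have "((\<lambda>x. 2 * a * \<sigma> / s * V x powr (- a - 1)) has_derivative
        (\<lambda>h. 4 * a * (a + 1) / s\<^sup>2 * V x powr (- a - 2) * ((x - c) \<bullet> h))) (at x)"
    proof (rule has_derivative_eq_rhs[OF has_derivative_mult_right[OF
            has_derivative_powr_const[OF dV pos[OF that]]]])
      have "2 * a * \<sigma> / s * ((- (2 * \<sigma> / s)) * y * ((- a - 1) * P)) =
          (\<sigma>\<^sup>2) * (4 * a * (a + 1) / s\<^sup>2 * P * y)" for y P
        using s by (simp add: field_simps power2_eq_square)
      moreover have "- a - 1 - 1 = - a - 2" by simp
      ultimately show "(\<lambda>h. 2 * a * \<sigma> / s * ((- (2 * \<sigma> / s) *\<^sub>R (x - c)) \<bullet> h * ((- a - 1) * V x powr (- a - 1 - 1)))) =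
          (\<lambda>h. 4 * a * (a + 1) / s\<^sup>2 * V x powr (- a - 2) * ((x - c) \<bullet> h))"
        using \<sigma> by (simp only: inner_scaleR_left fun_eq_iff) simp
    qed
    from has_derivative_scaleR[OF this has_derivative_diff[OF has_derivative_ident has_derivative_const]]
    show ?thesis unfolding G_def G'_def by simp
  qed
  have contV: "continuous_on S V"
    by (intro continuous_at_imp_continuous_on ballI has_derivative_continuous[OF dV])
  have contP: "continuous_on S (\<lambda>x. V x powr r)" for r
    by (intro continuous_on_powr contV continuous_on_const) (use pos in force)
  have contG': "continuous_on S (\<lambda>x. G' x h)" for h
    unfolding G'_def by (intro continuous_on_add continuous_on_scaleR continuous_on_mult
        continuous_on_inner continuous_on_diff continuous_on_id continuous_on_const contP)
  have Ck: "Ck 2 S (\<lambda>x. V x powr (- a))"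
    by (rule Ck_2I[OF \<open>open S\<close> dU dG contG'])
  have "laplacian (\<lambda>x. V x powr (- a)) x = N * (N - 2) * V x powr (- a - 2)" if "x \<in> S" for x
  proof -
    have "laplacian (\<lambda>x. V x powr (- a)) x = (\<Sum>i\<in>UNIV. G' x (axis i 1) $ i)"
      by (rule laplacian_eq[OF \<open>open S\<close> that dU dG[OF that]])
    also have "\<dots> = (\<Sum>i\<in>UNIV. 2 * a * \<sigma> / s * V x powr (- a - 1) +
        4 * a * (a + 1) / s\<^sup>2 * V x powr (- a - 2) * ((x - c) $ i * (x - c) $ i))"
      by (simp add: G'_def inner_axis mult.assoc)
    also have "\<dots> = N * (2 * a * \<sigma> / s * V x powr (- a - 1)) +
        4 * a * (a + 1) / s\<^sup>2 * V x powr (- a - 2) * (norm (x - c))\<^sup>2"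
      by (simp only: sum.distrib sum_distrib_left[symmetric])
        (simp add: N_def power2_norm_eq_inner inner_vec_def)
    also have "V x powr (- a - 1) = V x powr (- a - 2) * V x"
    proof -
      have "- a - 1 = (- a - 2) + 1" by simp
      then show ?thesis using pos[OF that] by (simp only: powr_add) simp
    qed
    also have "N * (2 * a * \<sigma> / s * (V x powr (- a - 2) * V x)) +
        4 * a * (a + 1) / s\<^sup>2 * V x powr (- a - 2) * (norm (x - c))\<^sup>2 =
        V x powr (- a - 2) * (N * (2 * a) * (\<sigma> * V x / s) + 4 * a * (a + 1) * ((norm (x - c))\<^sup>2 / s\<^sup>2))"
      by (simp add: distrib_left mult_ac add_divide_distrib)
    also have "\<sigma> * V x / s = \<sigma>\<^sup>2 * (s\<^sup>2 - (norm (x - c))\<^sup>2) / s\<^sup>2"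
      by (simp add: V_def model_radius_def power2_eq_square)
    also have "\<sigma>\<^sup>2 * (s\<^sup>2 - (norm (x - c))\<^sup>2) / s\<^sup>2 = 1 - (norm (x - c))\<^sup>2 / s\<^sup>2"
      using s \<sigma> by (simp add: diff_divide_distrib)
    also have "4 * a * (a + 1) = N * (N - 2)"
    proof -
      have "4 * a * (a + 1) = (2 * a) * (2 * a + 2)" by (simp add: algebra_simps)
      also have "2 * a = N - 2" by (simp add: a_def)
      finally show ?thesis by (simp add: mult.commute)
    qed
    also have "2 * a = N - 2"
      by (simp add: a_def)
    also have "V x powr (- a - 2) * (N * (N - 2) * (1 - (norm (x - c))\<^sup>2 / s\<^sup>2) +
        N * (N - 2) * ((norm (x - c))\<^sup>2 / s\<^sup>2)) = N * (N - 2) * V x powr (- a - 2)"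
      by (simp add: algebra_simps)
    finally show ?thesis .
  qed
  moreover have "(V x powr (- a)) powr ((N + 2) / (N - 2)) = V x powr (- a - 2)" if "N \<noteq> 2" for x
  proof -
    have "k / 2 * (l / k) = l / 2" if "k \<noteq> 0" for k l :: real using that by simp
    from this[of "N - 2" "N + 2"] that have "a * ((N + 2) / (N - 2)) = (N + 2) / 2"
      unfolding a_def by (simp only: right_minus_eq not_False_eq_True)
    also have "\<dots> = a + 2" by (simp add: a_def add_divide_distrib diff_divide_distrib)
    finally have "(- a) * ((N + 2) / (N - 2)) = - a - 2" by simp
    then show ?thesis by (simp only: powr_powr)
  qed
  ultimately have "- laplacian (\<lambda>x. V x powr (- a)) x + N * (N - 2) *
      (V x powr (- a)) powr ((N + 2) / (N - 2)) = 0" if "x \<in> S" for x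
    using that by (cases "N = 2") auto
  then show ?thesis
    unfolding classical_solution_def U using Ck pos by (force simp: N_def)
qed

lemma hyperbolic_radius_model_solution:
  fixes c :: "real^'n::finite"
  assumes "CARD('n) \<ge> 3" "model_radius \<sigma> s c x > 0"
  shows "hyperbolic_radius (model_solution \<sigma> s c) x = model_radius \<sigma> s c x"
proof -
  have "(- ((real CARD('n) - 2) / 2)) * (- 2 / (real CARD('n) - 2)) = 1"
    using assms(1) by (simp add: divide_simps)
  then show ?thesis
    using assms(2) by (simp only: hyperbolic_radius_def model_solution_def powr_powr) simp
qed

lemma hyperbolic_radius_antimono:
  fixes u :: "real^'n::finite \<Rightarrow> real"
  assumes "CARD('n) \<ge> 3" "0 < u x" "u x \<le> u' x"
  shows "hyperbolic_radius u' x \<le> hyperbolic_radius u x"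
  unfolding hyperbolic_radius_def by (rule powr_mono2') (use assms in auto)

text \<open>
  The model solution of the exterior of a ball, restricted to \<open>\<Omega>\<close>, is a competitor in the definition
  of maximality.
\<close>

lemma hyperbolic_radius_le_exterior:
  fixes \<Omega> :: "(real^'n::finite) set"
  assumes n: "CARD('n) \<ge> 3" and u: "maximal_solution \<Omega> u" and "open \<Omega>"
    and s: "s > 0" and ext: "\<And>x. x \<in> \<Omega> \<Longrightarrow> norm (x - c) > s" and x: "x \<in> \<Omega>"
  shows "hyperbolic_radius u x \<le> model_radius (- 1) s c x"
proof -
  have pos: "model_radius (- 1) s c x > 0" if "x \<in> \<Omega>" for x
    using ext[OF that] s by (simp add: model_radius_def power_strict_mono)
  have "classical_solution \<Omega> (model_solution (- 1) s c)"
    by (rule model_solution[OF s _ \<open>open \<Omega>\<close> pos]) simp_all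
  then have "model_solution (- 1) s c x \<le> u x"
    using u x by (auto simp: maximal_solution_def)
  moreover have "model_solution (- 1) s c x > 0"
    using pos[OF x] by (simp add: model_solution_def)
  ultimately have "hyperbolic_radius u x \<le> hyperbolic_radius (model_solution (- 1) s c) x"
    by (intro hyperbolic_radius_antimono n)
  then show ?thesis by (simp add: hyperbolic_radius_model_solution[OF n pos[OF x]])
qed

text \<open>
  The quotient \<open>F = u / U\<close> vanishes on the sphere, since \<open>U\<close> is infinite there and \<open>u\<close> is bounded. If
  its maximum \<open>F m\<close> were larger than \<open>1\<close>, then \<open>u - F m U\<close> would have an interior maximum at \<open>m\<close>, so that
  \<open>\<Delta>u \<le> F m \<Delta>U\<close>. By the equation this says \<open>(F m)\<^sup>p \<le> F m\<close> with \<open>p > 1\<close>, a contradiction.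
\<close>

lemma classical_solution_le_on_compact_ball:
  fixes \<Omega> :: "(real^'n::finite) set"
  assumes n: "CARD('n) \<ge> 3" and u: "classical_solution \<Omega> u"
    and \<rho>: "\<rho> > 0" "cball c \<rho> \<subseteq> \<Omega>" and x: "x \<in> ball c \<rho>"
  shows "u x \<le> model_solution 1 \<rho> c x"
proof -
  define V where "V = model_radius 1 \<rho> c"
  define N where "N = real CARD('n)"
  define a where "a = (N - 2) / 2"
  define p where "p = (N + 2) / (N - 2)"
  define U where "U = model_solution 1 \<rho> c"
  have N: "N \<ge> 3" using n by (simp add: N_def)
  have a: "a > 0" and p: "p > 1" using N by (auto simp: a_def p_def field_simps)
  have UV: "U y = V y powr (- a)" for y
    by (simp add: U_def model_solution_def V_def a_def N_def)
  have Vpos: "V y > 0" if "y \<in> ball c \<rho>" for y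
    using that \<rho> by (simp add: V_def model_radius_def dist_norm norm_minus_commute power_strict_mono)
  have Vnn: "V y \<ge> 0" if "y \<in> cball c \<rho>" for y
    using that \<rho> by (simp add: V_def model_radius_def dist_norm norm_minus_commute power_mono)
  have "continuous_on \<Omega> u"
    using u by (auto simp: classical_solution_def numeral_2_eq_2
        intro!: continuous_at_imp_continuous_on differentiable_imp_continuous_within)
  then have contu: "continuous_on (cball c \<rho>) u" using \<rho> continuous_on_subset by blast
  have contV: "continuous_on (cball c \<rho>) V"
    unfolding V_def model_radius_def by (intro continuous_intros) (use \<rho> in auto)
  \<comment> \<open>Multiplying by \<open>V\<^sup>a\<close> instead of dividing by \<open>U\<close> makes the quotient continuous up to the sphere,
    where \<open>0 powr a = 0\<close>.\<close>
  define F where "F = (\<lambda>y. u y * V y powr a)"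
  have contF: "continuous_on (cball c \<rho>) F"
    unfolding F_def by (intro continuous_intros contu continuous_on_powr' contV) (use Vnn a in auto)
  obtain m where m: "m \<in> cball c \<rho>" "\<And>y. y \<in> cball c \<rho> \<Longrightarrow> F y \<le> F m"
    using continuous_attains_sup[OF compact_cball _ contF] \<rho> by auto
  have uF: "u y = F y * U y" if "y \<in> ball c \<rho>" for y
    using Vpos[OF that] by (simp add: F_def UV powr_minus)
  have Upos: "U y > 0" if "y \<in> ball c \<rho>" for y
    using Vpos[OF that] by (simp add: UV)
  have "F m \<le> 1"
  proof (rule ccontr)
    assume F1: "\<not> F m \<le> 1"
    have mb: "m \<in> ball c \<rho>"
    proof (rule ccontr)
      assume "m \<notin> ball c \<rho>"
      then have "norm (m - c) = \<rho>" using m by (simp add: dist_norm norm_minus_commute)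
      then have "V m = 0" by (simp add: V_def model_radius_def)
      then show False using F1 by (simp add: F_def)
    qed
    have Usol: "classical_solution (ball c \<rho>) U"
      unfolding U_def by (rule model_solution[OF \<rho>(1)]) (use Vpos in \<open>auto simp: V_def\<close>)
    have "line_partials (ball c \<rho>) (\<lambda>y. u y - F m * U y)
       (\<lambda>i y. partial_deriv i u y - F m * partial_deriv i U y)
       (\<lambda>i y. partial_deriv i (partial_deriv i u) y - F m * partial_deriv i (partial_deriv i U) y)"
    proof (intro line_partials_diff line_partials_cmult)
      show "line_partials (ball c \<rho>) U (\<lambda>i. partial_deriv i U) (\<lambda>i. partial_deriv i (partial_deriv i U))"
        by (rule line_partials_Ck_2) (use Usol in \<open>simp add: classical_solution_def\<close>)
      show "line_partials (ball c \<rho>) u (\<lambda>i. partial_deriv i u) (\<lambda>i. partial_deriv i (partial_deriv i u))"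
        by (rule line_partials_subset[OF line_partials_Ck_2, of \<Omega>])
          (use u \<rho> in \<open>auto simp: classical_solution_def\<close>)
    qed
    moreover have "u y - F m * U y \<le> u m - F m * U m" if "y \<in> ball c \<rho>" for y
    proof -
      have "F y * U y \<le> F m * U y"
        by (rule mult_right_mono) (use m that Upos[OF that] in auto)
      then show ?thesis using uF[OF that] uF[OF mb] by simp
    qed
    ultimately have "(\<Sum>i\<in>UNIV. partial_deriv i (partial_deriv i u) m
        - F m * partial_deriv i (partial_deriv i U) m) \<le> 0"
      by (intro sum_nonpos line_partials_nonpos_at_max[OF open_ball mb])
    then have "laplacian u m \<le> F m * laplacian U m"
      by (simp add: laplacian_def sum_subtractf sum_distrib_left)
    moreover have "laplacian u m = N * (N - 2) * u m powr p"
      using u m \<rho> by (auto simp: classical_solution_def N_def p_def)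
    moreover have "laplacian U m = N * (N - 2) * U m powr p"
      using Usol mb by (auto simp: classical_solution_def N_def p_def)
    moreover have "u m powr p = F m powr p * U m powr p"
      using F1 Upos[OF mb] by (subst uF[OF mb]) (simp add: powr_mult)
    ultimately have "N * (N - 2) * (F m powr p * U m powr p) \<le> F m * (N * (N - 2) * U m powr p)"
      by simp
    then have "(N * (N - 2) * U m powr p) * F m powr p \<le> (N * (N - 2) * U m powr p) * F m"
      by (simp add: mult_ac)
    moreover have "N * (N - 2) * U m powr p > 0" using N Upos[OF mb] by simp
    ultimately have "F m powr p \<le> F m" by (simp only: mult_le_cancel_left_pos)
    moreover have "F m powr 1 < F m powr p" using F1 p by (intro powr_less_mono) auto
    ultimately show False using F1 by simp
  qed
  then have "F x \<le> 1" using m(2)[of x] x by force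
  then have "F x * U x \<le> 1 * U x" by (rule mult_right_mono) (use Upos[OF x] in simp)
  then show ?thesis using uF[OF x] by (simp add: U_def)
qed

text \<open>
  The closed balls of radius \<open>\<rho> < s\<close> lie inside \<open>\<Omega>\<close> even when the ball of radius \<open>s\<close> touches the
  boundary, so the comparison is made on them and \<open>\<rho>\<close> tends to \<open>s\<close>.
\<close>

lemma hyperbolic_radius_ge_interior:
  fixes \<Omega> :: "(real^'n::finite) set"
  assumes n: "CARD('n) \<ge> 3" and u: "classical_solution \<Omega> u"
    and s: "s > 0" "ball c s \<subseteq> \<Omega>" and x: "x \<in> ball c s"
  shows "model_radius 1 s c x \<le> hyperbolic_radius u x"
proof (rule tendsto_upperbound)
  have r: "norm (x - c) < s" using x by (simp add: dist_norm norm_minus_commute)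
  show "((\<lambda>\<rho>. model_radius 1 \<rho> c x) \<longlongrightarrow> model_radius 1 s c x) (at_left s)"
    unfolding model_radius_def by (intro tendsto_intros) (use s in auto)
  have "\<forall>\<^sub>F \<rho> in at_left s. \<rho> \<in> {norm (x - c)<..<s}"
    using r by (rule eventually_at_left_real)
  then show "\<forall>\<^sub>F \<rho> in at_left s. model_radius 1 \<rho> c x \<le> hyperbolic_radius u x"
  proof eventually_elim
    case (elim \<rho>)
    have \<rho>: "\<rho> > 0" using elim norm_ge_zero[of "x - c"] unfolding greaterThanLessThan_iff by linarith
    have xb: "x \<in> ball c \<rho>" using elim by (simp add: dist_norm norm_minus_commute)
    have sub: "cball c \<rho> \<subseteq> \<Omega>" using elim s by (auto simp: subset_eq)
    have "u x > 0" using u sub xb ball_subset_cball by (fastforce simp: classical_solution_def)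
    then have "hyperbolic_radius (model_solution 1 \<rho> c) x \<le> hyperbolic_radius u x"
      using classical_solution_le_on_compact_ball[OF n u \<rho> sub xb]
      by (rule hyperbolic_radius_antimono[where u=u, OF n])
    moreover have "model_radius 1 \<rho> c x > 0"
      using elim \<rho> by (simp add: model_radius_def power_strict_mono)
    ultimately show ?case by (simp add: hyperbolic_radius_model_solution[OF n])
  qed
qed simp

section \<open>Tangent balls of a domain with smooth boundary\<close>

lemma holder_imp_bounded_on_ball:
  fixes f :: "real^'n::finite \<Rightarrow> real"
  assumes "Ck_holder 0 \<alpha> (ball 0 r) f" "\<alpha> > 0" "r > 0"
  shows "\<exists>B. \<forall>x\<in>ball 0 r. \<bar>f x\<bar> \<le> B"
proof -
  obtain C where C: "\<And>x y. x \<in> ball 0 r \<Longrightarrow> y \<in> ball 0 r \<Longrightarrow> \<bar>f x - f y\<bar> \<le> C * dist x y powr \<alpha>"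
    using assms unfolding Ck_holder.simps by blast
  have "\<bar>f x\<bar> \<le> \<bar>f 0\<bar> + \<bar>C\<bar> * r powr \<alpha>" if x: "x \<in> ball 0 r" for x
  proof -
    have "\<bar>f x - f 0\<bar> \<le> C * dist x 0 powr \<alpha>" by (rule C[OF x]) (use assms in simp)
    also have "\<dots> \<le> \<bar>C\<bar> * dist x 0 powr \<alpha>" by (simp add: mult_right_mono)
    also have "\<dots> \<le> \<bar>C\<bar> * r powr \<alpha>"
      using x assms by (intro mult_left_mono powr_mono2) auto
    finally show ?thesis by linarith
  qed
  then show ?thesis by blast
qed

lemma lipschitz_if_bounded_partials:
  fixes f :: "real^'n::finite \<Rightarrow> real"
  assumes d: "\<And>x. x \<in> ball c r \<Longrightarrow> f differentiable (at x)"
    and b: "\<And>i. \<exists>B. \<forall>x\<in>ball c r. \<bar>partial_deriv i f x\<bar> \<le> B"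
  shows "\<exists>K\<ge>0. \<forall>x\<in>ball c r. \<forall>y\<in>ball c r. \<bar>f x - f y\<bar> \<le> K * norm (x - y)"
proof -
  obtain B where B: "\<And>i x. x \<in> ball c r \<Longrightarrow> \<bar>partial_deriv i f x\<bar> \<le> B i"
    using b by metis
  define K where "K = (\<Sum>i\<in>UNIV. \<bar>B i\<bar>)"
  have g: "norm (grad f x) \<le> K" if "x \<in> ball c r" for x
  proof -
    have "norm (grad f x) \<le> (\<Sum>i\<in>UNIV. \<bar>grad f x $ i\<bar>)" by (rule norm_le_l1_cart)
    also have "\<dots> \<le> K"
      unfolding K_def
    proof (rule sum_mono)
      fix i
      show "\<bar>grad f x $ i\<bar> \<le> \<bar>B i\<bar>"
        using B[OF that, of i] unfolding grad_def vec_lambda_beta by linarith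
    qed
    finally show ?thesis .
  qed
  have "onorm (\<lambda>h. grad f x \<bullet> h) \<le> K" if "x \<in> ball c r" for x
  proof (rule onorm_le)
    fix h :: "real^'n"
    show "norm (grad f x \<bullet> h) \<le> K * norm h"
      using Cauchy_Schwarz_ineq2[of "grad f x" h] mult_right_mono[OF g[OF that], of "norm h"] by simp
  qed
  then have "norm (f x - f y) \<le> K * norm (x - y)" if "x \<in> ball c r" "y \<in> ball c r" for x y
    by (intro differentiable_bound[of "ball c r" f "\<lambda>x h. grad f x \<bullet> h"] that)
      (auto intro!: has_derivative_at_withinI has_derivative_grad d)
  moreover have "K \<ge> 0" by (simp add: K_def sum_nonneg)
  ultimately show ?thesis by auto
qed

text \<open>
  In the coordinates \<open>y = T (x - p)\<close> the function \<open>y\<^sub>j - g y\<close> describes \<open>\<Omega>\<close> locally. Its gradient has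
  length at least \<open>1\<close>, because its \<open>j\<close>-th component in these coordinates is \<open>1\<close>: \<open>g\<close> is constant along
  that axis. The gradient is Lipschitz since Hoelder continuous second derivatives are bounded on a ball.
\<close>

lemma local_defining_function:
  fixes \<Omega> :: "(real^'n::finite) set"
  assumes \<Omega>: "bounded_Ck_holder_domain 2 \<alpha> \<Omega>" and "\<alpha> > 0" and p: "p \<in> frontier \<Omega>"
  obtains r f G K where "r > 0" "K \<ge> 0"
    and "\<forall>x\<in>ball p r. (f has_derivative (\<lambda>h. G x \<bullet> h)) (at x)"
    and "\<forall>x\<in>ball p r. G differentiable (at x)"
    and "\<forall>x\<in>ball p r. \<forall>y\<in>ball p r. norm (G x - G y) \<le> K * norm (x - y)"
    and "\<forall>x\<in>ball p r. norm (G x) \<ge> 1"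
    and "\<Omega> \<inter> ball p r = {x \<in> ball p r. 0 < f x}"
proof -
  obtain r and T :: "real^'n \<Rightarrow> real^'n" and j and g :: "real^'n \<Rightarrow> real"
    where r: "r > 0" and T: "orthogonal_transformation T"
    and inv: "\<forall>y t. g (y + axis j t) = g y" and g: "Ck_holder 2 \<alpha> (ball 0 r) g"
    and eq: "\<Omega> \<inter> ball p r = {x \<in> ball p r. g (T (x - p)) < T (x - p) $ j}"
    using \<Omega>[unfolded bounded_Ck_holder_domain_def, THEN conjunct2, THEN conjunct2, THEN conjunct2,
        THEN conjunct2, THEN bspec, OF p] by blast
  have linT: "linear T" and Tin: "\<And>v w. T v \<bullet> T w = v \<bullet> w"
    using T by (auto simp: orthogonal_transformation_def)
  have nT: "norm (T v) = norm v" for v by (rule orthogonal_transformation_norm[OF T])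
  have linI: "linear (inv T)" and nI: "\<And>v. norm (inv T v) = norm v"
    using orthogonal_transformation_inv[OF T]
    by (auto simp: orthogonal_transformation_def orthogonal_transformation_norm)
  have TI: "T (inv T w) = w" for w
    by (rule surj_f_inv_f[OF orthogonal_transformation_surj[OF T]])
  have adj: "inv T w \<bullet> h = w \<bullet> T h" for w h
    using Tin[of "inv T w" h] by (simp add: TI)
  have Tball: "T (x - p) \<in> ball 0 r" if "x \<in> ball p r" for x
    using that by (simp add: nT dist_norm norm_minus_commute)
  have gd: "g differentiable (at y)" "partial_deriv i g differentiable (at y)" if "y \<in> ball 0 r" for y i
    using g that by (auto simp: numeral_2_eq_2)
  have "\<exists>K\<ge>0. \<forall>x\<in>ball 0 r. \<forall>y\<in>ball 0 r. \<bar>partial_deriv i g x - partial_deriv i g y\<bar> \<le> K * norm (x - y)" for i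
  proof (rule lipschitz_if_bounded_partials)
    show "\<exists>B. \<forall>x\<in>ball 0 r. \<bar>partial_deriv j (partial_deriv i g) x\<bar> \<le> B" for j
      by (rule holder_imp_bounded_on_ball[OF _ \<open>\<alpha> > 0\<close> r])
        (use g in \<open>simp add: numeral_2_eq_2 del: Ck_holder.simps(1)\<close>)
  qed (use gd in auto)
  then obtain L where L: "\<And>i. L i \<ge> 0" "\<And>i x y. x \<in> ball 0 r \<Longrightarrow> y \<in> ball 0 r \<Longrightarrow>
      \<bar>partial_deriv i g x - partial_deriv i g y\<bar> \<le> L i * norm (x - y)"
    by metis
  define K where "K = (\<Sum>i\<in>UNIV. L i)"
  have gradL: "norm (grad g x - grad g y) \<le> K * norm (x - y)"
    if "x \<in> ball 0 r" "y \<in> ball 0 r" for x y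
  proof -
    have "norm (grad g x - grad g y) \<le> (\<Sum>i\<in>UNIV. \<bar>(grad g x - grad g y) $ i\<bar>)"
      by (rule norm_le_l1_cart)
    also have "\<dots> \<le> (\<Sum>i\<in>UNIV. L i * norm (x - y))"
      by (intro sum_mono) (use L that in \<open>simp add: grad_def\<close>)
    finally show ?thesis by (simp add: K_def sum_distrib_right)
  qed
  have grad_diff: "grad g differentiable (at y)" if "y \<in> ball 0 r" for y
  proof -
    have "grad g = (\<lambda>y. \<Sum>i\<in>UNIV. partial_deriv i g y *\<^sub>R axis i 1)"
      using basis_expansion[of "grad g _"] by (simp add: fun_eq_iff grad_def scalar_mult_eq_scaleR)
    moreover have "(\<lambda>y. \<Sum>i\<in>UNIV. partial_deriv i g y *\<^sub>R (axis i 1 :: real^'n)) differentiable (at y)"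
      by (intro differentiable_sum ballI differentiable_scaleR differentiable_const gd that) simp
    ultimately show ?thesis by simp
  qed
  have grad_j: "grad g y $ j = 0" if "y \<in> ball 0 r" for y
  proof -
    have "((\<lambda>t. g (y + t *\<^sub>R axis j 1)) has_real_derivative partial_deriv j g y) (at 0)"
      by (rule DERIV_along_axis[OF gd(1)[OF that]])
    moreover have "t *\<^sub>R axis j 1 = axis j (t::real)" for t
      by (simp add: vec_eq_iff axis_def)
    ultimately have "((\<lambda>t. g y) has_real_derivative partial_deriv j g y) (at 0)"
      by (simp add: inv)
    then have "partial_deriv j g y = 0" using DERIV_unique DERIV_const by blast
    then show ?thesis by (simp add: grad_def)
  qed
  define f where "f = (\<lambda>x. T (x - p) $ j - g (T (x - p)))"
  define G where "G = (\<lambda>x. inv T (axis j 1 - grad g (T (x - p))))"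
  have dT: "((\<lambda>x. T (x - p)) has_derivative T) (at x)" for x
  proof -
    have "((\<lambda>x. T (x - p)) has_derivative (\<lambda>h. T (h - 0))) (at x)"
      by (intro bounded_linear.has_derivative[OF linear_conv_bounded_linear[THEN iffD1, OF linT]]
          has_derivative_diff has_derivative_ident has_derivative_const)
    then show ?thesis by simp
  qed
  show thesis
  proof (rule that[of r K f G]; (intro ballI)?)
    show "r > 0" by fact
    show "K \<ge> 0" unfolding K_def by (intro sum_nonneg) (use L in auto)
    show "(f has_derivative (\<lambda>h. G x \<bullet> h)) (at x)" if "x \<in> ball p r" for x
    proof -
      have "((\<lambda>x. g (T (x - p))) has_derivative (\<lambda>h. grad g (T (x - p)) \<bullet> T h)) (at x)"
        by (rule has_derivative_compose[OF dT has_derivative_grad[OF gd(1)[OF Tball[OF that]]]])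
      moreover have "((\<lambda>x. T (x - p) $ j) has_derivative (\<lambda>h. T h $ j)) (at x)"
        by (rule bounded_linear.has_derivative[OF bounded_linear_vec_nth dT])
      ultimately have "(f has_derivative (\<lambda>h. T h $ j - grad g (T (x - p)) \<bullet> T h)) (at x)"
        unfolding f_def by (intro has_derivative_diff)
      moreover have "T h $ j - grad g (T (x - p)) \<bullet> T h = G x \<bullet> h" for h
        by (simp add: G_def adj inner_diff_left inner_axis')
      ultimately show ?thesis by simp
    qed
    show "G differentiable (at x)" if "x \<in> ball p r" for x
    proof -
      have "grad g differentiable (at (T (x - p)))" by (rule grad_diff[OF Tball[OF that]])
      then obtain D where D: "(grad g has_derivative D) (at (T (x - p)))"
        by (auto simp: differentiable_def)
      have "((\<lambda>x. axis j 1 - grad g (T (x - p))) has_derivative (\<lambda>h. 0 - D (T h))) (at x)"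
        by (intro has_derivative_diff has_derivative_const has_derivative_compose[OF dT D])
      from bounded_linear.has_derivative[OF linear_conv_bounded_linear[THEN iffD1, OF linI] this]
      show ?thesis unfolding G_def differentiable_def by blast
    qed
    show "norm (G x - G y) \<le> K * norm (x - y)" if "x \<in> ball p r" "y \<in> ball p r" for x y
    proof -
      have "G x - G y = inv T (grad g (T (y - p)) - grad g (T (x - p)))"
        by (simp add: G_def flip: linear_diff[OF linI])
      moreover have "norm (T (y - p) - T (x - p)) = norm (x - y)"
        by (simp add: nT norm_minus_commute flip: linear_diff[OF linT])
      ultimately show ?thesis
        using gradL[OF Tball[OF that(2)] Tball[OF that(1)]] by (simp add: nI)
    qed
    show "norm (G x) \<ge> 1" if "x \<in> ball p r" for x
    proof -
      have "(axis j 1 - grad g (T (x - p))) $ j = 1" using grad_j[OF Tball[OF that]] by simp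
      then show ?thesis using component_le_norm_cart[of "axis j 1 - grad g (T (x - p))" j]
        by (simp add: G_def nI)
    qed
    show "\<Omega> \<inter> ball p r = {x \<in> ball p r. 0 < f x}" using eq by (auto simp: f_def)
  qed
qed

text \<open>
  \<open>\<nu>\<close> is the inner unit normal at the boundary point \<open>q\<close>.
\<close>

definition tangent_balls :: "(real^'n::finite) set \<Rightarrow> real \<Rightarrow> real^'n \<Rightarrow> real^'n \<Rightarrow> bool" where
  "tangent_balls \<Omega> s q \<nu> \<longleftrightarrow> norm \<nu> = 1 \<and>
    ball (q + s *\<^sub>R \<nu>) s \<subseteq> \<Omega> \<and> ball (q - s *\<^sub>R \<nu>) s \<inter> \<Omega> = {}"

lemma tangent_balls_mono:
  assumes "tangent_balls \<Omega> s q \<nu>" "0 < s'" "s' \<le> s"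
  shows "tangent_balls \<Omega> s' q \<nu>"
proof -
  have *: "dist x (q + \<sigma> *\<^sub>R s *\<^sub>R \<nu>) < s" if "dist x (q + \<sigma> *\<^sub>R s' *\<^sub>R \<nu>) < s'" "\<bar>\<sigma>\<bar> = 1" for x \<sigma>
  proof -
    have "dist (q + \<sigma> *\<^sub>R s' *\<^sub>R \<nu>) (q + \<sigma> *\<^sub>R s *\<^sub>R \<nu>) = norm ((\<sigma> * (s' - s)) *\<^sub>R \<nu>)"
      by (simp add: dist_norm algebra_simps)
    also have "\<dots> = s - s'" using that assms by (simp add: tangent_balls_def abs_mult)
    finally show ?thesis
      using dist_triangle[of x "q + \<sigma> *\<^sub>R s *\<^sub>R \<nu>" "q + \<sigma> *\<^sub>R s' *\<^sub>R \<nu>"] that by linarith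
  qed
  have "ball (q + s' *\<^sub>R \<nu>) s' \<subseteq> ball (q + s *\<^sub>R \<nu>) s"
    using *[of _ 1] by (auto simp: dist_commute)
  moreover have "ball (q - s' *\<^sub>R \<nu>) s' \<subseteq> ball (q - s *\<^sub>R \<nu>) s"
    using *[of _ "-1"] by (auto simp: dist_commute)
  ultimately show ?thesis using assms(1) unfolding tangent_balls_def by blast
qed

text \<open>
  The normal \<open>\<nu>\<close> extends to a vector field \<open>N\<close> on a full neighbourhood of \<open>p\<close>, so that it can be
  differentiated as a function on the ambient space. Tying the Lipschitz constant to the radius \<open>s\<close>
  guarantees that \<open>h \<mapsto> h + t DN(p) h\<close> is invertible for \<open>t < s / 2\<close>, with room to spare.
\<close>

definition normal_field_at :: "(real^'n::finite) set \<Rightarrow> real \<Rightarrow> real^'n \<Rightarrow> bool" where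
  "normal_field_at \<Omega> s p \<longleftrightarrow> (\<exists>e>0. \<exists>N. N differentiable (at p) \<and>
    (\<forall>x\<in>ball p e. \<forall>y\<in>ball p e. norm (N x - N y) \<le> 1 / (2 * s) * norm (x - y)) \<and>
    (\<forall>q\<in>frontier \<Omega> \<inter> ball p e. tangent_balls \<Omega> s q (N q)))"

lemma normal_field_at_mono:
  assumes "normal_field_at \<Omega> s p" "0 < s'" "s' \<le> s"
  shows "normal_field_at \<Omega> s' p"
proof -
  obtain e N where *: "e > 0" "N differentiable (at p)"
    "\<And>x y. x\<in>ball p e \<Longrightarrow> y\<in>ball p e \<Longrightarrow> norm (N x - N y) \<le> 1 / (2 * s) * norm (x - y)"
    "\<And>q. q\<in>frontier \<Omega> \<inter> ball p e \<Longrightarrow> tangent_balls \<Omega> s q (N q)"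
    using assms(1) unfolding normal_field_at_def by blast
  have "1 / (2 * s) \<le> 1 / (2 * s')" using assms by (simp add: frac_le)
  then have "1 / (2 * s) * norm (x - y) \<le> 1 / (2 * s') * norm (x - y)" for x y :: "real^'a"
    by (rule mult_right_mono) simp
  then show ?thesis
    unfolding normal_field_at_def
  proof (intro exI[of _ e] exI[of _ N] conjI ballI)
    show "norm (N x - N y) \<le> 1 / (2 * s') * norm (x - y)" if "x \<in> ball p e" "y \<in> ball p e" for x y
      using *(3)[OF that] \<open>1 / (2 * s) * norm (x - y) \<le> 1 / (2 * s') * norm (x - y)\<close> by (rule order_trans)
    show "tangent_balls \<Omega> s' q (N q)" if "q \<in> frontier \<Omega> \<inter> ball p e" for q
      by (rule tangent_balls_mono[OF *(4)[OF that] assms(2,3)])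
  qed (rule *)+
qed

lemma norm_sgn_diff_le:
  fixes a b :: "'a::real_normed_vector"
  assumes "norm a \<ge> 1" "norm b \<ge> 1"
  shows "norm (sgn a - sgn b) \<le> 2 * norm (a - b)"
proof -
  have nz: "norm a \<noteq> 0" "norm b \<noteq> 0" using assms by linarith+
  have *: "inverse (norm a) * norm (a - b) \<le> 1 * norm (a - b)"
    using assms by (intro mult_right_mono) (auto simp: inverse_le_1_iff)
  have "inverse (norm a) - inverse (norm b) = inverse (norm a) * (norm b - norm a) * inverse (norm b)"
    using nz by (rule division_ring_inverse_diff)
  then have "\<bar>inverse (norm a) - inverse (norm b)\<bar> * norm b = inverse (norm a) * \<bar>norm b - norm a\<bar>"
    using nz by (simp add: abs_mult)
  also have "\<dots> \<le> inverse (norm a) * norm (a - b)"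
    using norm_triangle_ineq3[of b a] by (intro mult_left_mono) (simp_all add: norm_minus_commute)
  finally have **: "\<bar>inverse (norm a) - inverse (norm b)\<bar> * norm b \<le> norm (a - b)" using * by simp
  have eq: "sgn a - sgn b = inverse (norm a) *\<^sub>R (a - b) + (inverse (norm a) - inverse (norm b)) *\<^sub>R b"
    by (simp add: sgn_div_norm algebra_simps)
  have "norm (sgn a - sgn b) \<le>
      norm (inverse (norm a) *\<^sub>R (a - b)) + norm ((inverse (norm a) - inverse (norm b)) *\<^sub>R b)"
    unfolding eq by (rule norm_triangle_ineq)
  also have "\<dots> \<le> norm (a - b) + norm (a - b)"
    by (rule add_mono) (use * ** in simp_all)
  finally show ?thesis by simp
qed

text \<open>
  The normalised gradient of the defining function \<open>f\<close> serves as \<open>N\<close>. By Taylor's formula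
  \<open>f x = G q \<bullet> (x - q) + O(\<bar>x - q\<bar>\<^sup>2)\<close>, and in the ball of radius \<open>s\<close> touching at \<open>q\<close> the
  linear term dominates because there \<open>\<bar>x - q\<bar>\<^sup>2 < 2 s N q \<bullet> (x - q)\<close>.
\<close>

lemma normal_field_near_boundary_point:
  fixes \<Omega> :: "(real^'n::finite) set"
  assumes \<Omega>: "bounded_Ck_holder_domain 2 \<alpha> \<Omega>" and "\<alpha> > 0" and p: "p \<in> frontier \<Omega>"
  shows "\<exists>e>0. \<exists>s>0. \<forall>q\<in>frontier \<Omega> \<inter> ball p e. normal_field_at \<Omega> s q"
proof -
  obtain r f G K where r: "r > 0" and K: "K \<ge> 0"
    and f: "\<forall>x\<in>ball p r. (f has_derivative (\<lambda>h. G x \<bullet> h)) (at x)"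
    and Gd: "\<forall>x\<in>ball p r. G differentiable (at x)"
    and GL: "\<forall>x\<in>ball p r. \<forall>y\<in>ball p r. norm (G x - G y) \<le> K * norm (x - y)"
    and G1: "\<forall>x\<in>ball p r. norm (G x) \<ge> 1"
    and eq: "\<Omega> \<inter> ball p r = {x \<in> ball p r. 0 < f x}"
    by (rule local_defining_function[OF assms])
  note f = f[rule_format] and Gd = Gd[rule_format] and GL = GL[rule_format] and G1 = G1[rule_format]
  have "open \<Omega>" using \<Omega> by (simp add: bounded_Ck_holder_domain_def)
  have f0: "f q = 0" if q: "q \<in> frontier \<Omega>" "q \<in> ball p r" for q
  proof -
    have "q \<notin> \<Omega>" using q \<open>open \<Omega>\<close> by (simp add: frontier_def interior_open)
    then have "f q \<le> 0" using eq q by force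
    moreover have "f q \<ge> 0"
    proof (rule ccontr)
      assume "\<not> f q \<ge> 0"
      have "isCont f q" by (rule has_derivative_continuous[OF f[OF q(2)]])
      then have "\<forall>\<^sub>F x in nhds q. f x < 0"
        using \<open>\<not> f q \<ge> 0\<close> by (simp add: isCont_def tendsto_at_iff_tendsto_nhds order_tendstoD)
      moreover have "\<forall>\<^sub>F x in nhds q. x \<in> ball p r"
        using q by (intro eventually_nhds_in_open) auto
      ultimately have "\<forall>\<^sub>F x in nhds q. x \<notin> \<Omega>"
        by eventually_elim (use eq in force)
      then obtain S where "open S" "q \<in> S" "S \<inter> \<Omega> = {}"
        unfolding eventually_nhds by blast
      then show False
        using q open_Int_closure_eq_empty[of S \<Omega>] by (auto simp: frontier_def)
    qed
    ultimately show ?thesis by simp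
  qed
  have taylor: "\<bar>f x - f q - G q \<bullet> (x - q)\<bar> \<le> K * (norm (x - q))\<^sup>2"
    if q: "q \<in> ball p r" and x: "x \<in> ball p r" for x q
  proof -
    let ?S = "closed_segment q x"
    have S: "?S \<subseteq> ball p r" using q x by (simp add: closed_segment_subset)
    have "norm ((f x - G q \<bullet> x) - (f q - G q \<bullet> q)) \<le> (K * norm (x - q)) * norm (x - q)"
    proof (rule differentiable_bound[of ?S "\<lambda>x. f x - G q \<bullet> x" "\<lambda>y h. G y \<bullet> h - G q \<bullet> h"])
      fix y assume y: "y \<in> ?S"
      show "((\<lambda>x. f x - G q \<bullet> x) has_derivative (\<lambda>h. G y \<bullet> h - G q \<bullet> h)) (at y within ?S)"
        by (intro has_derivative_diff has_derivative_at_withinI[OF f[OF subsetD[OF S y]]]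
            has_derivative_inner_right has_derivative_ident)
      show "onorm (\<lambda>h. G y \<bullet> h - G q \<bullet> h) \<le> K * norm (x - q)"
      proof (rule onorm_le)
        fix h :: "real^'n"
        have "norm (G y \<bullet> h - G q \<bullet> h) \<le> norm (G y - G q) * norm h"
          using Cauchy_Schwarz_ineq2[of "G y - G q" h] by (simp add: inner_diff_left)
        also have "\<dots> \<le> (K * norm (x - q)) * norm h"
        proof (rule mult_right_mono)
          have "norm (y - q) \<le> norm (x - q)"
            using segment_bound(1)[OF y] by simp
          then have "K * norm (y - q) \<le> K * norm (x - q)" using K by (rule mult_left_mono)
          with GL[OF subsetD[OF S y] q] show "norm (G y - G q) \<le> K * norm (x - q)" by (rule order_trans)
        qed simp
        finally show "norm (G y \<bullet> h - G q \<bullet> h) \<le> K * norm (x - q) * norm h" .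
      qed
    qed simp_all
    moreover have "(f x - G q \<bullet> x) - (f q - G q \<bullet> q) = f x - f q - G q \<bullet> (x - q)"
      by (simp add: inner_diff_right)
    ultimately show ?thesis by (simp only: power2_eq_square real_norm_def mult.assoc)
  qed
  define N where "N = (\<lambda>x. sgn (G x))"
  define s where "s = min (r / 8) (1 / (4 * (K + 1)))"
  have s: "s > 0" "s \<le> r / 8" using r K by (auto simp: s_def)
  have sK: "s * (4 * (K + 1)) \<le> 1"
  proof -
    have "s \<le> 1 / (4 * (K + 1))" by (simp add: s_def)
    then show ?thesis using K by (simp add: pos_le_divide_eq)
  qed
  have Nd: "N differentiable (at x)" if "x \<in> ball p r" for x
  proof -
    have nz: "G x \<noteq> 0" using G1[OF that] by auto
    then have "(\<lambda>x. norm (G x)) differentiable (at x)"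
      using Gd[OF that] by (intro differentiable_norm_at differentiable_compose[of norm, unfolded o_def])
    then have "(\<lambda>x. inverse (norm (G x))) differentiable (at x)"
      using nz by (intro differentiable_inverse) auto
    then show ?thesis
      unfolding N_def sgn_div_norm using Gd[OF that] by (intro differentiable_scaleR)
  qed
  have NL: "norm (N x - N y) \<le> 1 / (2 * s) * norm (x - y)" if "x \<in> ball p r" "y \<in> ball p r" for x y
  proof -
    have "norm (N x - N y) \<le> 2 * norm (G x - G y)"
      unfolding N_def by (rule norm_sgn_diff_le) (use G1 that in auto)
    also have "\<dots> \<le> 2 * K * norm (x - y)" using GL[OF that] by simp
    also have "\<dots> \<le> 1 / (2 * s) * norm (x - y)"
    proof (rule mult_right_mono)
      have "2 * K * (2 * s) \<le> 1" using sK s by (simp add: algebra_simps)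
      then show "2 * K \<le> 1 / (2 * s)" using s by (simp add: pos_le_divide_eq)
    qed simp
    finally show ?thesis .
  qed
  have tb: "tangent_balls \<Omega> s q (N q)" if q: "q \<in> frontier \<Omega>" "q \<in> ball p (r / 2)" for q
  proof -
    have qr: "q \<in> ball p r" using q(2) r by auto
    have N1: "norm (N q) = 1" unfolding N_def using G1[OF qr] by (auto simp: norm_sgn)
    have GN: "G q = norm (G q) *\<^sub>R N q" 
    proof -
      have "norm (G q) \<noteq> 0" using G1[OF qr] by linarith
      then show ?thesis by (simp add: N_def sgn_div_norm)
    qed
    \<comment> \<open>\<open>\<sigma> = 1\<close> for the interior and \<open>\<sigma> = - 1\<close> for the exterior ball.\<close>
    have key: "x \<in> ball p r \<and> (norm (x - q))\<^sup>2 * K < \<sigma> * (G q \<bullet> (x - q))"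
      if x: "dist x (q + (\<sigma> * s) *\<^sub>R N q) < s" and \<sigma>: "\<bar>\<sigma>\<bar> = 1" for x \<sigma>
    proof -
      define y where "y = x - q"
      have y: "norm (y - (\<sigma> * s) *\<^sub>R N q) < s" using x by (simp add: y_def dist_norm algebra_simps)
      then have "(norm (y - (\<sigma> * s) *\<^sub>R N q))\<^sup>2 < s\<^sup>2" by (simp add: power_strict_mono)
      moreover have "(norm (y - (\<sigma> * s) *\<^sub>R N q))\<^sup>2 = (norm y)\<^sup>2 - 2 * s * \<sigma> * (N q \<bullet> y) + s\<^sup>2"
      proof -
        have "N q \<bullet> N q = 1" using N1 by (simp add: dot_square_norm)
        have "\<sigma> * \<sigma> = 1" using \<sigma> abs_mult_self_eq[of \<sigma>] by simp
        then have e: "(\<sigma> * s) * (\<sigma> * s) = s\<^sup>2"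
          using mult.assoc[of "\<sigma> * \<sigma>" s s] by (simp add: power2_eq_square mult.left_commute)
        have "(norm (y - k *\<^sub>R N q))\<^sup>2 = (norm y)\<^sup>2 - 2 * k * (N q \<bullet> y) + k * k" for k
          unfolding power2_norm_eq_inner inner_diff_left inner_diff_right inner_scaleR_left inner_scaleR_right
            inner_commute[of y "N q"] using \<open>N q \<bullet> N q = 1\<close> by (simp add: algebra_simps)
        from this[of "\<sigma> * s", unfolded e] show ?thesis by (simp add: mult_ac)
      qed
      ultimately have 1: "(norm y)\<^sup>2 < 2 * s * (\<sigma> * (N q \<bullet> y))" by simp
      have pos: "\<sigma> * (N q \<bullet> y) > 0"
      proof -
        have "0 < 2 * s * (\<sigma> * (N q \<bullet> y))" using 1 zero_le_power2[of "norm y"] by linarith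
        then show ?thesis using s by (simp add: zero_less_mult_iff)
      qed
      have "(norm y)\<^sup>2 * K \<le> 2 * s * (\<sigma> * (N q \<bullet> y)) * K"
        using 1 K by (intro mult_right_mono) auto
      also have "\<dots> = (2 * s * K) * (\<sigma> * (N q \<bullet> y))" by simp
      also have "\<dots> < 1 * (\<sigma> * (N q \<bullet> y))"
      proof (rule mult_strict_right_mono[OF _ pos])
        show "2 * s * K < 1" using sK s by (simp add: algebra_simps)
      qed
      also have "\<dots> \<le> norm (G q) * (\<sigma> * (N q \<bullet> y))"
        by (rule mult_right_mono[OF G1[OF qr]]) (use pos in simp)
      also have "\<dots> = \<sigma> * (G q \<bullet> y)" by (subst (2) GN) simp
      finally have 2: "(norm y)\<^sup>2 * K < \<sigma> * (G q \<bullet> y)" .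
      have "norm y \<le> norm (y - (\<sigma> * s) *\<^sub>R N q) + norm ((\<sigma> * s) *\<^sub>R N q)"
        using norm_triangle_ineq[of "y - (\<sigma> * s) *\<^sub>R N q" "(\<sigma> * s) *\<^sub>R N q"] by simp
      also have "\<dots> < s + s" using y N1 \<sigma> s by (simp add: abs_mult)
      finally have "dist x q < r / 2" using s r by (simp add: y_def dist_norm)
      moreover have "dist p q < r / 2" using q by simp
      ultimately have "x \<in> ball p r"
        using dist_triangle[of p x q] by (simp add: dist_commute)
      then show ?thesis using 2 by (simp add: y_def)
    qed
    have "x \<in> \<Omega>" if "x \<in> ball (q + s *\<^sub>R N q) s" for x
    proof -
      have k: "x \<in> ball p r" "(norm (x - q))\<^sup>2 * K < G q \<bullet> (x - q)"
        using key[of x 1] that by (auto simp: dist_commute)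
      then have "f x > 0"
        using taylor[OF qr k(1)] f0[OF q(1) qr] by (simp add: mult.commute abs_le_iff)
      then show ?thesis using eq k by blast
    qed
    moreover have "x \<notin> \<Omega>" if "x \<in> ball (q - s *\<^sub>R N q) s" for x
    proof -
      have k: "x \<in> ball p r" "(norm (x - q))\<^sup>2 * K < - (G q \<bullet> (x - q))"
        using key[of x "-1"] that by (auto simp: dist_commute)
      then have "f x < 0"
        using taylor[OF qr k(1)] f0[OF q(1) qr] by (simp add: mult.commute abs_le_iff)
      then show ?thesis using eq k by force
    qed
    ultimately show ?thesis using N1 by (auto simp: tangent_balls_def)
  qed
  have "normal_field_at \<Omega> s q" if "q \<in> frontier \<Omega> \<inter> ball p (r / 4)" for q
    unfolding normal_field_at_def
  proof (intro exI[of _ "r / 4"] exI[of _ N] conjI ballI)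
    have sub: "ball q (r / 4) \<subseteq> ball p (r / 2)"
    proof
      fix x assume "x \<in> ball q (r / 4)"
      then show "x \<in> ball p (r / 2)" using that dist_triangle[of p x q] by simp
    qed
    have sub': "ball p (r / 2) \<subseteq> ball p r" using r by (simp add: subset_ball)
    show "r / 4 > 0" using r by simp
    show "N differentiable (at q)" using Nd that r by auto
    show "norm (N x - N y) \<le> 1 / (2 * s) * norm (x - y)"
      if "x \<in> ball q (r / 4)" "y \<in> ball q (r / 4)" for x y
      using NL that sub sub' by blast
    show "tangent_balls \<Omega> s y (N y)" if "y \<in> frontier \<Omega> \<inter> ball q (r / 4)" for y
      using tb that sub by blast
  qed
  then show ?thesis using r s by (intro exI[of _ "r / 4"] conjI exI[of _ s]) auto
qed

lemma uniform_normal_field: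
  fixes \<Omega> :: "(real^'n::finite) set"
  assumes \<Omega>: "bounded_Ck_holder_domain 2 \<alpha> \<Omega>" and "\<alpha> > 0"
  obtains s where "s > 0" "\<And>p. p \<in> frontier \<Omega> \<Longrightarrow> normal_field_at \<Omega> s p"
proof -
  obtain e s where es: "\<And>p. p \<in> frontier \<Omega> \<Longrightarrow> e p > 0 \<and> s p > 0 \<and>
      (\<forall>q\<in>frontier \<Omega> \<inter> ball p (e p). normal_field_at \<Omega> (s p) q)"
    using normal_field_near_boundary_point[OF assms] by metis
  have "compact (frontier \<Omega>)"
    using \<Omega> by (intro compact_frontier_bounded) (simp add: bounded_Ck_holder_domain_def)
  moreover have "frontier \<Omega> \<subseteq> (\<Union>p\<in>frontier \<Omega>. ball p (e p))" using es by force
  ultimately obtain F where F: "F \<subseteq> frontier \<Omega>" "finite F" "frontier \<Omega> \<subseteq> (\<Union>p\<in>F. ball p (e p))"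
    using compactE_image[of "frontier \<Omega>" "frontier \<Omega>" "\<lambda>p. ball p (e p)"] by (metis open_ball)
  define m where "m = Min (insert 1 (s ` F))"
  have m: "m > 0" unfolding m_def using F es by auto
  show thesis
  proof (rule that[OF m])
    fix q assume q: "q \<in> frontier \<Omega>"
    then obtain p where p: "p \<in> F" "q \<in> ball p (e p)" using F by blast
    have "m \<le> s p" unfolding m_def using F p by simp
    then show "normal_field_at \<Omega> m q"
      using es[of p] p q F m normal_field_at_mono[of \<Omega> "s p" q m] by blast
  qed
qed

section \<open>Regularity of the distance to the boundary\<close>

lemma has_derivative_squeeze:
  fixes f g h :: "'a::real_normed_vector \<Rightarrow> real"
  assumes g: "(g has_derivative D) (at x)" and h: "(h has_derivative D) (at x)"
    and S: "open S" "x \<in> S" and le: "\<And>y. y \<in> S \<Longrightarrow> g y \<le> f y \<and> f y \<le> h y"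
    and eq: "g x = f x" "h x = f x"
  shows "(f has_derivative D) (at x)"
  unfolding has_derivative_at_alt
proof (intro conjI allI impI)
  show "bounded_linear D" by (rule has_derivative_bounded_linear[OF g])
  fix e :: real assume "e > 0"
  obtain d1 where d1: "d1 > 0" "\<And>y. norm (y - x) < d1 \<Longrightarrow> norm (g y - g x - D (y - x)) \<le> e * norm (y - x)"
    using g \<open>e > 0\<close> unfolding has_derivative_at_alt by blast
  obtain d2 where d2: "d2 > 0" "\<And>y. norm (y - x) < d2 \<Longrightarrow> norm (h y - h x - D (y - x)) \<le> e * norm (y - x)"
    using h \<open>e > 0\<close> unfolding has_derivative_at_alt by blast
  obtain d3 where d3: "d3 > 0" "ball x d3 \<subseteq> S" using S openE by blast
  show "\<exists>d>0. \<forall>y. norm (y - x) < d \<longrightarrow> norm (f y - f x - D (y - x)) \<le> e * norm (y - x)"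
  proof (intro exI[of _ "min d1 (min d2 d3)"] conjI allI impI)
    fix y assume y: "norm (y - x) < min d1 (min d2 d3)"
    then have "y \<in> S" using d3 by (auto simp: subset_eq dist_norm norm_minus_commute)
    then show "norm (f y - f x - D (y - x)) \<le> e * norm (y - x)"
      using d1(2)[of y] d2(2)[of y] le[of y] eq y by (simp add: abs_le_iff)
  qed (use d1 d2 d3 in simp)
qed

text \<open>
  Only differences with the value at \<open>x\<close> enter the hypothesis: for the gradient of the distance a bound
  of this one-sided kind is what the comparison of foot points provides.
\<close>

lemma has_derivative_norm_bound:
  fixes f :: "'a::real_normed_vector \<Rightarrow> 'b::real_normed_vector"
  assumes f: "(f has_derivative D) (at x)" and "r > 0"
    and L: "\<And>y. norm (y - x) < r \<Longrightarrow> norm (f y - f x) \<le> K * norm (y - x)"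
  shows "norm (D h) \<le> K * norm h"
proof (cases "h = 0")
  case True
  then show ?thesis using linear_0[OF has_derivative_linear[OF f]] by simp
next
  case False
  have "norm (D h) / norm h \<le> K"
  proof (rule field_le_epsilon)
    fix e :: real assume "e > 0"
    obtain d where d: "d > 0" "\<And>y. norm (y - x) < d \<Longrightarrow> norm (f y - f x - D (y - x)) \<le> e * norm (y - x)"
      using f \<open>e > 0\<close> unfolding has_derivative_at_alt by blast
    define t where "t = min d r / (2 * norm h)"
    have t: "t > 0" using d \<open>r > 0\<close> False by (simp add: t_def)
    have th: "norm (t *\<^sub>R h) = t * norm h" using t by simp
    have "t * norm h = min d r / 2" using False by (simp add: t_def)
    then have small: "norm ((x + t *\<^sub>R h) - x) < d" "norm ((x + t *\<^sub>R h) - x) < r"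
      using d \<open>r > 0\<close> th by auto
    have "D (t *\<^sub>R h) = (f (x + t *\<^sub>R h) - f x) - (f (x + t *\<^sub>R h) - f x - D (x + t *\<^sub>R h - x))"
      by simp
    then have "norm (D (t *\<^sub>R h)) \<le> norm (f (x + t *\<^sub>R h) - f x)
        + norm (f (x + t *\<^sub>R h) - f x - D (x + t *\<^sub>R h - x))"
      using norm_triangle_ineq4 by metis
    also have "\<dots> \<le> K * norm (x + t *\<^sub>R h - x) + e * norm (x + t *\<^sub>R h - x)"
      by (rule add_mono[OF L[OF small(2)] d(2)[OF small(1)]])
    also have "\<dots> = (K + e) * (t * norm h)"
      unfolding add_diff_cancel_left' th by (rule distrib_right[symmetric])
    finally have "norm (D (t *\<^sub>R h)) \<le> (K + e) * (t * norm h)" .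
    moreover have "norm (D (t *\<^sub>R h)) = t * norm (D h)"
      using t linear_cmul[OF has_derivative_linear[OF f]] by simp
    ultimately have "t * norm (D h) \<le> t * ((K + e) * norm h)" by (simp add: mult.left_commute)
    then have "norm (D h) \<le> (K + e) * norm h" using t by (simp only: mult_le_cancel_left_pos)
    then show "norm (D h) / norm h \<le> K + e" using False by (simp add: pos_divide_le_eq)
  qed
  then show ?thesis using False by (simp add: pos_divide_le_eq)
qed

text \<open>
  The segment from \<open>y\<close> to the nearest point of the exterior ball leaves \<open>\<Omega>\<close>, hence meets the boundary.
\<close>

lemma boundary_dist_le_exterior:
  fixes \<Omega> :: "(real^'n::finite) set"
  assumes "open \<Omega>" and s: "s > 0" and ext: "ball c s \<inter> \<Omega> = {}" and y: "y \<in> \<Omega>"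
  shows "norm (y - c) > s" and "boundary_dist \<Omega> y \<le> norm (y - c) - s"
proof -
  have cb: "cball c s \<inter> \<Omega> = {}"
    using open_Int_closure_eq_empty[OF \<open>open \<Omega>\<close>, of "ball c s"] ext s by (auto simp: Int_commute)
  then show far: "norm (y - c) > s"
    using y by (force simp: dist_norm norm_minus_commute)
  define z where "z = c + (s / norm (y - c)) *\<^sub>R (y - c)"
  have nz: "norm (y - c) \<noteq> 0" using far s by linarith
  then have "dist c z = s" using s by (simp add: z_def dist_norm)
  then have z: "z \<notin> \<Omega>" using cb by (force simp: dist_commute)
  have "y - z = (1 - s / norm (y - c)) *\<^sub>R (y - c)"
    by (simp add: z_def algebra_simps)
  then have "dist y z = \<bar>1 - s / norm (y - c)\<bar> * norm (y - c)" by (simp add: dist_norm)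
  also have "\<dots> = norm (y - c) - s"
  proof -
    have "s / norm (y - c) \<le> 1" using far s by (simp add: divide_le_eq_1)
    then have "\<bar>1 - s / norm (y - c)\<bar> = 1 - s / norm (y - c)" by simp
    then show ?thesis using nz by (simp add: left_diff_distrib)
  qed
  finally have dyz: "dist y z = norm (y - c) - s" .
  have "closed_segment y z \<inter> frontier \<Omega> \<noteq> {}"
    by (rule connected_Int_frontier) (use y z in auto)
  then obtain q where q: "q \<in> closed_segment y z" "q \<in> frontier \<Omega>" by blast
  have "boundary_dist \<Omega> y \<le> dist y q"
    unfolding boundary_dist_def by (rule infdist_le[OF q(2)])
  also have "\<dots> \<le> dist y z"
    using segment_bound(1)[OF q(1)] by (simp add: dist_norm norm_minus_commute)
  finally show "boundary_dist \<Omega> y \<le> norm (y - c) - s" using dyz by simp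
qed

lemma boundary_dist_ge_interior:
  fixes \<Omega> :: "(real^'n::finite) set"
  assumes "open \<Omega>" and int: "ball c s \<subseteq> \<Omega>" and q: "q \<in> frontier \<Omega>"
  shows "norm (q - c) \<ge> s" and "s - norm (y - c) \<le> boundary_dist \<Omega> y"
proof -
  have far: "norm (q' - c) \<ge> s" if "q' \<in> frontier \<Omega>" for q'
  proof -
    have "q' \<notin> \<Omega>" using that \<open>open \<Omega>\<close> by (simp add: frontier_def interior_open)
    then have "q' \<notin> ball c s" using int by blast
    then show ?thesis by (simp add: dist_norm norm_minus_commute)
  qed
  then show "norm (q - c) \<ge> s" using q .
  obtain q' where q': "q' \<in> frontier \<Omega>" "infdist y (frontier \<Omega>) = dist y q'"
    using infdist_attains_inf[of "frontier \<Omega>" y] q by auto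
  have "norm (q' - c) \<le> dist y q' + norm (y - c)"
    using norm_triangle_ineq[of "q' - y" "y - c"] by (simp add: dist_norm norm_minus_commute)
  then show "s - norm (y - c) \<le> boundary_dist \<Omega> y"
    using far[OF q'(1)] q'(2) by (simp add: boundary_dist_def)
qed

text \<open>
  The exterior ball forces \<open>\<bar>x - ce\<bar> \<ge> s + d x = \<bar>p - ce\<bar> + \<bar>x - p\<bar>\<close> for its centre \<open>ce\<close>. This is
  equality in the triangle inequality, so \<open>x\<close> lies on the normal through \<open>p\<close>. Then the distances to the
  two spheres enclose \<open>d\<close>, agree with it at \<open>x\<close> and have the same gradient \<open>\<nu>\<close> there.
\<close>

lemma foot_point_and_gradient:
  fixes \<Omega> :: "(real^'n::finite) set"
  assumes "open \<Omega>" and s: "s > 0" and x: "x \<in> \<Omega>" "0 < boundary_dist \<Omega> x" "boundary_dist \<Omega> x < s"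
    and p: "p \<in> frontier \<Omega>" "boundary_dist \<Omega> x = dist x p" and tb: "tangent_balls \<Omega> s p \<nu>"
  shows "x = p + boundary_dist \<Omega> x *\<^sub>R \<nu>"
    and "(boundary_dist \<Omega> has_derivative (\<lambda>h. \<nu> \<bullet> h)) (at x)"
proof -
  define d where "d = boundary_dist \<Omega> x"
  define ci where "ci = p + s *\<^sub>R \<nu>"
  define ce where "ce = p - s *\<^sub>R \<nu>"
  have n1: "norm \<nu> = 1" and int: "ball ci s \<subseteq> \<Omega>" and ext: "ball ce s \<inter> \<Omega> = {}"
    using tb by (auto simp: tangent_balls_def ci_def ce_def)
  have d: "d = norm (x - p)" "0 < d" "d < s" using p x by (auto simp: d_def dist_norm)
  have "norm (x - p) + norm (s *\<^sub>R \<nu>) \<le> norm ((x - p) + s *\<^sub>R \<nu>)"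
    using boundary_dist_le_exterior(2)[OF \<open>open \<Omega>\<close> s ext x(1)] d n1 s
    by (simp add: d_def ce_def algebra_simps)
  then have "norm ((x - p) + s *\<^sub>R \<nu>) = norm (x - p) + norm (s *\<^sub>R \<nu>)"
    using norm_triangle_ineq[of "x - p" "s *\<^sub>R \<nu>"] by linarith
  then have "norm (x - p) *\<^sub>R (s *\<^sub>R \<nu>) = norm (s *\<^sub>R \<nu>) *\<^sub>R (x - p)"
    by (simp only: norm_triangle_eq)
  then have "s *\<^sub>R (x - p) = s *\<^sub>R (d *\<^sub>R \<nu>)"
    using n1 s d by (simp add: mult.commute)
  then have xp: "x - p = d *\<^sub>R \<nu>" by (rule scaleR_left_imp_eq[rotated]) (use s in simp)
  then show "x = p + boundary_dist \<Omega> x *\<^sub>R \<nu>" by (simp add: d_def algebra_simps)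
  have xi: "x - ci = - ((s - d) *\<^sub>R \<nu>)" and xe: "x - ce = (s + d) *\<^sub>R \<nu>"
    using xp by (simp_all add: ci_def ce_def algebra_simps)
  have ni: "norm (x - ci) = s - d" "norm (x - ce) = s + d"
    unfolding xi xe norm_minus_cancel norm_scaleR n1 using d s by simp_all
  have sgn_i: "sgn (x - ci) = - \<nu>" and sgn_e: "sgn (x - ce) = \<nu>"
  proof -
    have "s - d \<noteq> 0" "s + d \<noteq> 0" using d(2,3) s by linarith+
    then show "sgn (x - ci) = - \<nu>" "sgn (x - ce) = \<nu>"
      unfolding sgn_div_norm ni unfolding xi xe by simp_all
  qed
  have "norm (x - ci) \<noteq> 0" "norm (x - ce) \<noteq> 0" using ni d(2,3) s by linarith+
  then have nz: "x - ci \<noteq> 0" "x - ce \<noteq> 0" by (simp_all only: norm_eq_zero not_False_eq_True)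
  have dn: "((\<lambda>y. norm (y - c)) has_derivative (\<lambda>h. sgn (x - c) \<bullet> h)) (at x)" if "x - c \<noteq> 0" for c
  proof -
    have "((\<lambda>y. norm (y - c)) has_derivative (\<lambda>h. (h - 0) \<bullet> sgn (x - c))) (at x)"
      by (rule has_derivative_compose[OF has_derivative_diff[OF has_derivative_ident has_derivative_const]
            has_derivative_norm[OF that]])
    then show ?thesis by (simp add: inner_commute)
  qed
  show "(boundary_dist \<Omega> has_derivative (\<lambda>h. \<nu> \<bullet> h)) (at x)"
  proof (rule has_derivative_squeeze[OF _ _ \<open>open \<Omega>\<close> x(1)])
    show "((\<lambda>y. s - norm (y - ci)) has_derivative (\<lambda>h. \<nu> \<bullet> h)) (at x)"
      using has_derivative_diff[OF has_derivative_const dn[OF nz(1)], of s] by (simp add: sgn_i)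
    show "((\<lambda>y. norm (y - ce) - s) has_derivative (\<lambda>h. \<nu> \<bullet> h)) (at x)"
      using has_derivative_diff[OF dn[OF nz(2)] has_derivative_const, of s] by (simp add: sgn_e)
    show "s - norm (y - ci) \<le> boundary_dist \<Omega> y \<and> boundary_dist \<Omega> y \<le> norm (y - ce) - s"
      if "y \<in> \<Omega>" for y
      using boundary_dist_ge_interior(2)[OF \<open>open \<Omega>\<close> int p(1)]
        boundary_dist_le_exterior(2)[OF \<open>open \<Omega>\<close> s ext that] by blast
    show "s - norm (x - ci) = boundary_dist \<Omega> x" "norm (x - ce) - s = boundary_dist \<Omega> x"
      using ni by (simp_all add: d_def)
  qed
qed

lemma nearest_boundary_point:
  fixes \<Omega> :: "(real^'n::finite) set"
  assumes "0 < boundary_dist \<Omega> x"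
  obtains p where "p \<in> frontier \<Omega>" "boundary_dist \<Omega> x = dist x p"
proof -
  have "frontier \<Omega> \<noteq> {}" using assms by (auto simp: boundary_dist_def infdist_def)
  then show thesis
    using infdist_attains_inf[of "frontier \<Omega>" x] that by (auto simp: boundary_dist_def)
qed

text \<open>
  The point \<open>p\<close> minimises the distance to \<open>x\<close> with quadratic growth among the points outside the larger
  ball of radius \<open>s\<close>: for them \<open>\<bar>q - x\<bar>\<^sup>2 \<ge> \<delta>\<^sup>2 + (1 - \<delta> / s) \<bar>q - p\<bar>\<^sup>2\<close>. Hence a point \<open>q\<close> that is at
  least as near to \<open>y\<close> as \<open>p\<close> is cannot be far from \<open>p\<close> when \<open>y\<close> is near \<open>x\<close>.
\<close>

lemma foot_point_lipschitz:
  fixes \<nu> :: "'a::real_inner"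
  assumes x: "x = p + \<delta> *\<^sub>R \<nu>" and \<delta>: "0 < \<delta>" "\<delta> \<le> s / 2" and n1: "norm \<nu> = 1"
    and out: "norm (q - (p + s *\<^sub>R \<nu>)) \<ge> s" and near: "norm (y - q) \<le> norm (y - p)"
  shows "norm (q - p) \<le> 4 * norm (y - x)"
proof -
  define z where "z = q - p"
  have s: "s > 0" using \<delta> by linarith
  have nn: "\<nu> \<bullet> \<nu> = 1" using n1 by (simp add: dot_square_norm)
  have "s\<^sup>2 \<le> (norm (z - s *\<^sub>R \<nu>))\<^sup>2"
    using out s by (intro power_mono) (auto simp: z_def algebra_simps)
  also have "\<dots> = z \<bullet> z - 2 * s * (\<nu> \<bullet> z) + s\<^sup>2"
    unfolding power2_norm_eq_inner inner_diff_left inner_diff_right inner_scaleR_left inner_scaleR_right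
      inner_commute[of z \<nu>] nn by (simp add: power2_eq_square right_diff_distrib)
  finally have 1: "2 * s * (\<nu> \<bullet> z) \<le> z \<bullet> z" by simp
  have "(norm ((y - p) - z))\<^sup>2 \<le> (norm (y - p))\<^sup>2"
    using near by (intro power_mono) (auto simp: z_def)
  also have "(norm ((y - p) - z))\<^sup>2 = (norm (y - p))\<^sup>2 - 2 * ((y - p) \<bullet> z) + z \<bullet> z"
    unfolding power2_norm_eq_inner inner_diff_left[of "y - p" z] inner_diff_right[of _ "y - p" z]
      inner_commute[of z "y - p"] by simp
  finally have 2: "z \<bullet> z \<le> 2 * ((y - p) \<bullet> z)" by simp
  have "y - p = (y - x) + \<delta> *\<^sub>R \<nu>" using x by simp
  then have "(y - p) \<bullet> z = (y - x) \<bullet> z + \<delta> * (\<nu> \<bullet> z)"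
    by (simp only: inner_add_left inner_scaleR_left)
  moreover have "2 * \<delta> * (\<nu> \<bullet> z) \<le> (z \<bullet> z) / 2"
  proof -
    have "2 * \<delta> * (\<nu> \<bullet> z) = (\<delta> / s) * (2 * s * (\<nu> \<bullet> z))" using s by simp
    also have "\<dots> \<le> (\<delta> / s) * (z \<bullet> z)" using 1 \<delta> s by (intro mult_left_mono) auto
    also have "\<dots> \<le> (1 / 2) * (z \<bullet> z)"
      using \<delta> s by (intro mult_right_mono) (auto simp: divide_le_eq)
    finally show ?thesis by simp
  qed
  moreover have "(y - x) \<bullet> z \<le> norm (y - x) * norm z" by (rule norm_cauchy_schwarz)
  ultimately have "(z \<bullet> z) / 2 \<le> 2 * (norm (y - x) * norm z)" using 2 by linarith
  then have "norm z * norm z \<le> norm z * (4 * norm (y - x))"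
    by (simp add: dot_square_norm power2_eq_square mult_ac)
  then show ?thesis
    by (cases "norm z = 0") (auto simp: z_def mult_le_cancel_left)
qed


lemma has_derivative_boundary_dist_in_collar:
  fixes \<Omega> :: "(real^'n::finite) set"
  assumes "open \<Omega>" and s: "s > 0" and nf: "\<And>p. p \<in> frontier \<Omega> \<Longrightarrow> normal_field_at \<Omega> s p"
    and y: "y \<in> \<Omega>" "0 < boundary_dist \<Omega> y" "boundary_dist \<Omega> y < s"
  obtains p \<nu> where "tangent_balls \<Omega> s p \<nu>" "p \<in> frontier \<Omega>"
    "y = p + boundary_dist \<Omega> y *\<^sub>R \<nu>" "grad (boundary_dist \<Omega>) y = \<nu>"
    "(boundary_dist \<Omega> has_derivative (\<lambda>h. \<nu> \<bullet> h)) (at y)"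
proof -
  obtain p where p: "p \<in> frontier \<Omega>" "boundary_dist \<Omega> y = dist y p"
    using nearest_boundary_point[OF y(2)] .
  obtain e N where "e > 0" "\<forall>q\<in>frontier \<Omega> \<inter> ball p e. tangent_balls \<Omega> s q (N q)"
    using nf[OF p(1)] unfolding normal_field_at_def by blast
  then have tb: "tangent_balls \<Omega> s p (N p)" using p by simp
  note fp = foot_point_and_gradient[OF \<open>open \<Omega>\<close> s y p tb]
  show thesis by (rule that[OF tb p(1) fp(1) grad_eq[OF fp(2)] fp(2)])
qed

text \<open>
  The foot point map \<open>P\<close> satisfies \<open>y = P y + d y N(P y)\<close>. With \<open>\<delta> = d x\<close> and \<open>A\<close> the derivative of \<open>N\<close> at
  \<open>p = P x\<close>, linearising at \<open>x\<close> gives \<open>(1 + \<delta> A) (P y - p) = B (y - x) + o(\<bar>y - x\<bar>)\<close>, where \<open>B\<close> is the orthogonal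
  projection along the normal; the remainder is small because \<open>P\<close> is already known to be Lipschitz
  at \<open>x\<close>. As \<open>1 + \<delta> A\<close> is invertible, \<open>P\<close> is differentiable at \<open>x\<close>, and so is \<open>\<nabla>d = N \<circ> P\<close>.
\<close>

lemma grad_boundary_dist_differentiable:
  fixes \<Omega> :: "(real^'n::finite) set"
  assumes "open \<Omega>" and s: "s > 0" and nf: "\<And>p. p \<in> frontier \<Omega> \<Longrightarrow> normal_field_at \<Omega> s p"
    and x: "x \<in> \<Omega>" "0 < boundary_dist \<Omega> x" "boundary_dist \<Omega> x < s / 2"
  shows "\<exists>D. (grad (boundary_dist \<Omega>) has_derivative D) (at x) \<and> (\<forall>h. norm (D h) \<le> 2 / s * norm h)"
proof -
  define d where "d = boundary_dist \<Omega>"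
  define G where "G = grad d"
  define P where "P = (\<lambda>y. y - d y *\<^sub>R G y)"
  define \<delta> where "\<delta> = d x"
  have \<delta>: "0 < \<delta>" "\<delta> < s / 2" using x by (auto simp: \<delta>_def d_def)
  obtain p where p: "p \<in> frontier \<Omega>" "boundary_dist \<Omega> x = dist x p"
    using nearest_boundary_point[OF x(2)] .
  obtain e N where e: "e > 0" and Nd: "N differentiable (at p)"
    and NL: "\<forall>y\<in>ball p e. \<forall>z\<in>ball p e. norm (N y - N z) \<le> 1 / (2 * s) * norm (y - z)"
    and tb: "\<forall>q\<in>frontier \<Omega> \<inter> ball p e. tangent_balls \<Omega> s q (N q)"
    using nf[OF p(1)] unfolding normal_field_at_def by blast
  have tbp: "tangent_balls \<Omega> s p (N p)" using tb p e by simp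
  have xp: "x = p + \<delta> *\<^sub>R N p"
    unfolding \<delta>_def d_def
    by (rule foot_point_and_gradient(1)[OF \<open>open \<Omega>\<close> s x(1,2) _ p tbp]) (use x s in linarith)
  have N1: "norm (N p) = 1" using tbp by (simp add: tangent_balls_def)
  have d_lip: "\<bar>d y - d z\<bar> \<le> norm (y - z)" for y z
    using infdist_triangle_abs[of y "frontier \<Omega>" z] by (simp add: d_def boundary_dist_def dist_norm)
  obtain ro where ro: "ro > 0" "ball x ro \<subseteq> \<Omega>" using \<open>open \<Omega>\<close> x(1) openE by blast
  define r where "r = min (min ro (e / 4)) (min \<delta> (s / 2))"
  have r: "r > 0" "r \<le> ro" "r \<le> e / 4" "r \<le> \<delta>" "r \<le> s / 2"
    using ro e \<delta> s by (auto simp: r_def)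
  have foot: "P y \<in> frontier \<Omega> \<inter> ball p e \<and> G y = N (P y) \<and> norm (P y - p) \<le> 4 * norm (y - x) \<and>
      y = P y + d y *\<^sub>R N (P y) \<and> (d has_derivative (\<lambda>h. N (P y) \<bullet> h)) (at y)"
    if y: "norm (y - x) < r" for y
  proof -
    have yO: "y \<in> \<Omega>" using ro r y by (auto simp: subset_eq dist_norm norm_minus_commute)
    have dy: "0 < d y" "d y < s" using d_lip[of y x] y r \<delta> by (auto simp: \<delta>_def abs_le_iff)
    obtain q where q: "q \<in> frontier \<Omega>" "boundary_dist \<Omega> y = dist y q"
      using nearest_boundary_point[of \<Omega> y] dy by (auto simp: d_def)
    have qp: "norm (q - p) \<le> 4 * norm (y - x)"
    proof (rule foot_point_lipschitz[OF xp \<delta>(1) _ N1])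
      show "\<delta> \<le> s / 2" using \<delta> by simp
      show "norm (q - (p + s *\<^sub>R N p)) \<ge> s"
        by (rule boundary_dist_ge_interior(1)[OF \<open>open \<Omega>\<close> _ q(1)])
          (use tbp in \<open>simp add: tangent_balls_def\<close>)
      have "boundary_dist \<Omega> y \<le> dist y p"
        unfolding boundary_dist_def by (rule infdist_le[OF p(1)])
      then show "norm (y - q) \<le> norm (y - p)" using q(2) by (simp add: dist_norm)
    qed
    then have qe: "q \<in> frontier \<Omega> \<inter> ball p e"
      using q r y by (simp add: dist_norm norm_minus_commute)
    then have tbq: "tangent_balls \<Omega> s q (N q)" using tb by blast
    note fp = foot_point_and_gradient[OF \<open>open \<Omega>\<close> s yO dy[unfolded d_def] q tbq, folded d_def]
    have Gy: "G y = N q" unfolding G_def by (rule grad_eq[OF fp(2)])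
    then have "P y = q" unfolding P_def using fp(1) by (metis add_diff_cancel_right')
    then show ?thesis using qp qe Gy fp by simp
  qed
  have Px: "P x = p" using foot[of x] r by simp
  have dd: "(d has_derivative (\<lambda>h. N p \<bullet> h)) (at x)" using foot[of x] r Px by simp
  obtain A where A: "(N has_derivative A) (at p)" using Nd by (auto simp: differentiable_def)
  have linA: "linear A" by (rule has_derivative_linear[OF A])
  have A_le: "norm (A h) \<le> 1 / (2 * s) * norm h" for h
    by (rule has_derivative_norm_bound[OF A e]) (use NL e in \<open>simp add: dist_norm norm_minus_commute\<close>)
  define M where "M = (\<lambda>h. h + \<delta> *\<^sub>R A h)"
  define B where "B = (\<lambda>h. h - (N p \<bullet> h) *\<^sub>R N p)"
  have linM: "linear M"
    unfolding M_def by (intro linear_compose_add linear_compose_scale_right linA linear_ident)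
  have "inj M"
  proof -
    have "h = 0" if "M h = 0" for h
    proof (rule ccontr)
      assume "h \<noteq> 0"
      have "h = - (\<delta> *\<^sub>R A h)" using that by (simp add: M_def eq_neg_iff_add_eq_0)
      then have "norm h = \<delta> * norm (A h)" using \<delta> by (metis norm_minus_cancel norm_scaleR abs_of_pos)
      also have "\<dots> \<le> (s / 2) * (1 / (2 * s) * norm h)"
        by (rule mult_mono) (use \<delta> A_le in auto)
      also have "\<dots> = norm h / 4" using s by simp
      finally show False using \<open>h \<noteq> 0\<close> by simp
    qed
    then show ?thesis using linear_injective_0[OF linM] by blast
  qed
  then obtain L where L: "linear L" "L \<circ> M = id"
    using linear_injective_left_inverse[OF linM] by blast
  have LM: "L (M h) = h" for h using L(2) by (metis comp_apply id_apply)
  have blL: "bounded_linear L" using L(1) by (simp add: linear_conv_bounded_linear)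
  obtain K where K: "K > 0" "\<And>h. norm (L h) \<le> norm h * K"
    using bounded_linear.pos_bounded[OF blL] by blast
  have blB: "bounded_linear B"
    unfolding B_def by (intro bounded_linear_intros)
  have dP: "(P has_derivative (\<lambda>h. L (B h))) (at x)"
    unfolding has_derivative_at_alt
  proof (intro conjI allI impI)
    show "bounded_linear (\<lambda>h. L (B h))" by (rule bounded_linear_compose[OF blL blB])
    fix \<epsilon> :: real assume \<epsilon>: "\<epsilon> > 0"
    \<comment> \<open>The three error terms below add up to \<open>\<eta> (4 \<delta> + 2) \<bar>y - x\<bar>\<close>, and applying \<open>L\<close> costs a factor \<open>K\<close>.\<close>
    define \<eta> where "\<eta> = \<epsilon> / (K * (4 * \<delta> + 2))"
    have \<eta>: "\<eta> > 0" using \<epsilon> K \<delta> by (simp add: \<eta>_def)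
    obtain r1 where r1: "r1 > 0" "\<And>y. norm (y - p) < r1 \<Longrightarrow> norm (N y - N p - A (y - p)) \<le> \<eta> * norm (y - p)"
      using A \<eta> unfolding has_derivative_at_alt by blast
    obtain r2 where r2: "r2 > 0" "\<And>y. norm (y - x) < r2 \<Longrightarrow> norm (d y - d x - N p \<bullet> (y - x)) \<le> \<eta> * norm (y - x)"
      using dd \<eta> unfolding has_derivative_at_alt by blast
    define r3 where "r3 = min (min r (r1 / 4)) (min r2 (\<eta> * s / 2))"
    have r3: "r3 > 0" using r r1 r2 \<eta> s by (simp add: r3_def)
    show "\<exists>r>0. \<forall>y. norm (y - x) < r \<longrightarrow> norm (P y - P x - L (B (y - x))) \<le> \<epsilon> * norm (y - x)"
    proof (intro exI[of _ r3] conjI allI impI r3)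
      fix y assume "norm (y - x) < r3"
      then have y: "norm (y - x) < r" "norm (y - x) < r1 / 4" "norm (y - x) < r2" "norm (y - x) < \<eta> * s / 2"
        by (auto simp: r3_def)
      note f = foot[OF y(1)]
      define D where "D = norm (y - x)"
      define DP where "DP = P y - p"
      define DN where "DN = N (P y) - N p"
      have DP: "norm DP \<le> 4 * D" using f by (simp add: DP_def D_def)
      have t1: "norm (A DP - DN) \<le> \<eta> * (4 * D)"
      proof -
        have "norm (P y - p) < r1" using DP y by (simp add: DP_def D_def)
        from r1(2)[OF this] have "norm (A DP - DN) \<le> \<eta> * norm DP"
          by (simp add: DP_def DN_def norm_minus_commute)
        also have "\<dots> \<le> \<eta> * (4 * D)" using DP \<eta> by (intro mult_left_mono) auto
        finally show ?thesis .
      qed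
      have t2: "\<bar>N p \<bullet> (y - x) - (d y - \<delta>)\<bar> \<le> \<eta> * D"
        using r2(2)[OF y(3)] by (simp add: \<delta>_def D_def abs_minus_commute)
      have t3: "norm ((d y - \<delta>) *\<^sub>R DN) \<le> \<eta> * D"
      proof -
        have "norm DN \<le> 1 / (2 * s) * norm DP"
          using NL f e by (simp add: DN_def DP_def)
        also have "\<dots> \<le> 1 / (2 * s) * (4 * D)" using DP s by (intro mult_left_mono) auto
        also have "\<dots> \<le> \<eta>"
          using y(4) s by (simp add: D_def field_simps)
        finally have "norm DN \<le> \<eta>" .
        moreover have "\<bar>d y - \<delta>\<bar> \<le> D" using d_lip[of y x] by (simp add: \<delta>_def D_def)
        ultimately have "\<bar>d y - \<delta>\<bar> * norm DN \<le> D * \<eta>" by (intro mult_mono) auto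
        then show ?thesis by (simp add: mult.commute)
      qed
      have yx: "y - x = DP + (d y - \<delta>) *\<^sub>R N p + \<delta> *\<^sub>R DN + (d y - \<delta>) *\<^sub>R DN"
      proof -
        have "y - x = (P y + d y *\<^sub>R N (P y)) - (p + \<delta> *\<^sub>R N p)" using f xp by metis
        also have "\<dots> = DP + (d y *\<^sub>R N (P y) - \<delta> *\<^sub>R N p)" by (simp add: DP_def)
        also have "d y *\<^sub>R N (P y) - \<delta> *\<^sub>R N p = (d y - \<delta>) *\<^sub>R N p + d y *\<^sub>R DN"
          by (simp add: DN_def scaleR_diff_left scaleR_diff_right)
        also have "d y *\<^sub>R DN = \<delta> *\<^sub>R DN + (d y - \<delta>) *\<^sub>R DN"
          by (simp flip: scaleR_left_distrib)
        finally show ?thesis by (simp only: add.assoc)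
      qed
      have "M DP - B (y - x) = \<delta> *\<^sub>R (A DP - DN) + (N p \<bullet> (y - x) - (d y - \<delta>)) *\<^sub>R N p
          - (d y - \<delta>) *\<^sub>R DN"
      proof -
        have "B (y - x) = DP + (d y - \<delta>) *\<^sub>R N p + \<delta> *\<^sub>R DN + (d y - \<delta>) *\<^sub>R DN - (N p \<bullet> (y - x)) *\<^sub>R N p"
          unfolding B_def by (subst (1) yx) simp
        then show ?thesis by (simp add: M_def algebra_simps)
      qed
      moreover have "norm (a + b - c) \<le> norm a + norm b + norm c" for a b c :: "real^'n"
        using norm_triangle_ineq4[of "a + b" c] norm_triangle_ineq[of a b] by linarith
      ultimately have "norm (M DP - B (y - x)) \<le> norm (\<delta> *\<^sub>R (A DP - DN))
          + norm ((N p \<bullet> (y - x) - (d y - \<delta>)) *\<^sub>R N p) + norm ((d y - \<delta>) *\<^sub>R DN)"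
        by (simp only:)
      also have "\<dots> \<le> \<delta> * (\<eta> * (4 * D)) + \<eta> * D + \<eta> * D"
      proof (intro add_mono)
        show "norm (\<delta> *\<^sub>R (A DP - DN)) \<le> \<delta> * (\<eta> * (4 * D))"
          using mult_left_mono[OF t1, of \<delta>] \<delta> by simp
        show "norm ((N p \<bullet> (y - x) - (d y - \<delta>)) *\<^sub>R N p) \<le> \<eta> * D"
          using t2 N1 by simp
      qed (fact t3)
      also have "\<dots> = \<eta> * (4 * \<delta> + 2) * D" by (simp add: algebra_simps)
      finally have le: "norm (M DP - B (y - x)) \<le> \<eta> * (4 * \<delta> + 2) * D" .
      have "P y - P x - L (B (y - x)) = L (M DP - B (y - x))"
        by (simp add: linear_diff[OF L(1)] LM Px DP_def)
      then have "norm (P y - P x - L (B (y - x))) \<le> norm (M DP - B (y - x)) * K"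
        using K(2) by simp
      also have "\<dots> \<le> \<eta> * (4 * \<delta> + 2) * D * K"
        using le K(1) by (intro mult_right_mono) auto
      also have "\<dots> = \<epsilon> * D"
      proof -
        have "K * (4 * \<delta> + 2) \<noteq> 0" using K \<delta> by auto
        then have "\<eta> * (K * (4 * \<delta> + 2)) = \<epsilon>" unfolding \<eta>_def by (rule nonzero_eq_divide_eq[THEN iffD1, OF _ refl])
        then show ?thesis by (simp add: mult_ac)
      qed
      finally show "norm (P y - P x - L (B (y - x))) \<le> \<epsilon> * norm (y - x)" by (simp add: D_def)
    qed
  qed
  have "((\<lambda>y. N (P y)) has_derivative (\<lambda>h. A (L (B h)))) (at x)"
    by (rule has_derivative_compose[OF dP]) (simp add: Px A)
  then have dG: "(G has_derivative (\<lambda>h. A (L (B h)))) (at x)"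
  proof (rule has_derivative_transform_within_open[of _ _ _ _ "ball x r"])
    show "N (P y) = G y" if "y \<in> ball x r" for y
      using foot[of y] that by (simp add: dist_norm norm_minus_commute)
  qed (use r in auto)
  moreover have "norm (A (L (B h))) \<le> 2 / s * norm h" for h
  proof (rule has_derivative_norm_bound[OF dG r(1)])
    fix y assume y: "norm (y - x) < r"
    have "norm (G y - G x) = norm (N (P y) - N p)"
      using foot[OF y] foot[of x] r Px by simp
    also have "\<dots> \<le> 1 / (2 * s) * norm (P y - p)"
      using NL foot[OF y] e by simp
    also have "\<dots> \<le> 1 / (2 * s) * (4 * norm (y - x))"
      using foot[OF y] s by (intro mult_left_mono) auto
    finally show "norm (G y - G x) \<le> 2 / s * norm (y - x)" using s by (simp add: field_simps)
  qed
  ultimately show ?thesis unfolding G_def d_def by blast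
qed

lemma laplacian_boundary_dist_bound:
  fixes \<Omega> :: "(real^'n::finite) set"
  assumes "open \<Omega>" and s: "s > 0" and nf: "\<And>p. p \<in> frontier \<Omega> \<Longrightarrow> normal_field_at \<Omega> s p"
    and x: "x \<in> \<Omega>" "0 < boundary_dist \<Omega> x" "boundary_dist \<Omega> x < s / 2"
  shows "\<bar>laplacian (boundary_dist \<Omega>) x\<bar> \<le> 2 * real CARD('n) / s"
proof -
  define S where "S = {y \<in> \<Omega>. boundary_dist \<Omega> y \<in> {0<..<s}}"
  have cont: "continuous_on \<Omega> (boundary_dist \<Omega>)"
    unfolding boundary_dist_def by (intro continuous_intros)
  have "open S"
    using continuous_open_preimage[OF cont \<open>open \<Omega>\<close>, of "{0<..<s}"]
    by (simp add: S_def vimage_def Int_def)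
  moreover have "x \<in> S" using x s by (simp add: S_def)
  moreover have "(boundary_dist \<Omega> has_derivative (\<lambda>h. grad (boundary_dist \<Omega>) y \<bullet> h)) (at y)" if "y \<in> S" for y
  proof -
    have y: "y \<in> \<Omega>" "0 < boundary_dist \<Omega> y" "boundary_dist \<Omega> y < s" using that by (auto simp: S_def)
    show ?thesis
      by (rule has_derivative_boundary_dist_in_collar[OF \<open>open \<Omega>\<close> s nf y]) simp_all
  qed
  moreover obtain D where D: "(grad (boundary_dist \<Omega>) has_derivative D) (at x)"
    "\<And>h. norm (D h) \<le> 2 / s * norm h"
    using grad_boundary_dist_differentiable[OF \<open>open \<Omega>\<close> s nf x] by blast
  ultimately have "laplacian (boundary_dist \<Omega>) x = (\<Sum>i\<in>UNIV. D (axis i 1) $ i)"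
    by (intro laplacian_eq)
  also have "\<bar>\<dots>\<bar> \<le> (\<Sum>i\<in>(UNIV::'n set). 2 / s)"
  proof (rule order_trans[OF sum_abs sum_mono])
    fix i :: 'n
    show "\<bar>D (axis i 1) $ i\<bar> \<le> 2 / s"
      using component_le_norm_cart[of "D (axis i 1)" i] D(2)[of "axis i 1"] by simp
  qed
  finally show ?thesis by (simp add: mult.commute)
qed

section \<open>Boundary asymptotics of the hyperbolic radius\<close>

lemma powr_minus_diff_bounds:
  fixes m X Y b :: real
  assumes m: "0 < m" "m \<le> X" and XY: "X \<le> Y" and b: "b > 0"
  shows "0 \<le> X powr (- b) - Y powr (- b)"
    and "X powr (- b) - Y powr (- b) \<le> b * m powr (- b - 1) * (Y - X)"
proof -
  show "0 \<le> X powr (- b) - Y powr (- b)"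
    using powr_mono2'[of "- b" X Y] assms by simp
  show "X powr (- b) - Y powr (- b) \<le> b * m powr (- b - 1) * (Y - X)"
  proof (cases "X = Y")
    case False
    then have "X < Y" using XY by simp
    have "\<exists>\<xi>. \<xi> > X \<and> \<xi> < Y \<and> Y powr (- b) - X powr (- b) = (Y - X) * (- b * \<xi> powr (- b - 1))"
    proof (rule MVT2[OF \<open>X < Y\<close>])
      fix t assume "X \<le> t" "t \<le> Y"
      then show "((\<lambda>t. t powr (- b)) has_real_derivative - b * t powr (- b - 1)) (at t)"
        using m by (intro has_real_derivative_powr) linarith
    qed
    then obtain \<xi> where \<xi>: "X < \<xi>" "Y powr (- b) - X powr (- b) = (Y - X) * (- b * \<xi> powr (- b - 1))"
      by blast
    have "\<xi> powr (- b - 1) \<le> m powr (- b - 1)"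
      using \<xi>(1) m b by (intro powr_mono2') auto
    then have "b * (Y - X) * \<xi> powr (- b - 1) \<le> b * (Y - X) * m powr (- b - 1)"
      using b XY by (intro mult_left_mono) auto
    then show ?thesis using \<xi>(2) by (simp add: mult_ac)
  qed simp
qed

lemma powr_diff_le:
  fixes X Y b :: real
  assumes X: "0 < X" and XY: "X \<le> Y" and b: "b \<ge> 1"
  shows "Y powr b - X powr b \<le> b * Y powr (b - 1) * (Y - X)"
proof (cases "X = Y")
  case False
  then have "X < Y" using XY by simp
  have "\<exists>\<xi>. \<xi> > X \<and> \<xi> < Y \<and> Y powr b - X powr b = (Y - X) * (b * \<xi> powr (b - 1))"
  proof (rule MVT2[OF \<open>X < Y\<close>])
    fix t assume "X \<le> t" "t \<le> Y"
    then show "((\<lambda>t. t powr b) has_real_derivative b * t powr (b - 1)) (at t)"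
      using X by (intro has_real_derivative_powr) linarith
  qed
  then obtain \<xi> where \<xi>: "X < \<xi>" "\<xi> < Y" "Y powr b - X powr b = (Y - X) * (b * \<xi> powr (b - 1))"
    by blast
  have "\<xi> powr (b - 1) \<le> Y powr (b - 1)"
    using \<xi> X b by (intro powr_mono2) auto
  then have "b * (Y - X) * \<xi> powr (b - 1) \<le> b * (Y - X) * Y powr (b - 1)"
    using b XY by (intro mult_left_mono) auto
  then show ?thesis using \<xi>(3) by (simp add: mult_ac)
qed simp

lemma classical_solution_subset:
  assumes "classical_solution \<Omega> u" "S \<subseteq> \<Omega>"
  shows "classical_solution S u"
  using assms continuous_on_subset unfolding classical_solution_def numeral_2_eq_2 Ck.simps by blast

text \<open>
  Powers of \<open>u\<close> turned into powers of its hyperbolic radius, which near the boundary is comparable to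
  the distance.
\<close>

lemma classical_solution_via_radius:
  fixes u :: "real^'n::finite \<Rightarrow> real"
  defines "N \<equiv> real CARD('n)"
  defines "a \<equiv> (N - 2) / 2"
  assumes n: "CARD('n) \<ge> 3" and u: "classical_solution S u" and y: "y \<in> S"
  shows "hyperbolic_radius u y > 0"
    and "u y = hyperbolic_radius u y powr (- a)"
    and "laplacian u y = N * (N - 2) * hyperbolic_radius u y powr (- (a + 2))"
    and "(hyperbolic_radius u has_derivative
      (\<lambda>h. ((- (1 / a) * hyperbolic_radius u y powr (a + 1)) *\<^sub>R grad u y) \<bullet> h)) (at y)"
proof -
  have N: "N \<ge> 3" using n by (simp add: N_def)
  have a: "a > 0" using N by (simp add: a_def)
  have upos: "u y > 0" using u y by (simp add: classical_solution_def)
  have v: "hyperbolic_radius u = (\<lambda>y. u y powr (- (1 / a)))"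
    by (simp add: fun_eq_iff hyperbolic_radius_def a_def N_def)
  show "hyperbolic_radius u y > 0" using upos by (simp add: v)
  show uv: "u y = hyperbolic_radius u y powr (- a)"
    using upos a by (simp add: v powr_powr)
  have "laplacian u y = N * (N - 2) * u y powr ((N + 2) / (N - 2))"
    using u y by (auto simp: classical_solution_def N_def)
  also have "u y powr ((N + 2) / (N - 2)) = hyperbolic_radius u y powr (- (a + 2))"
  proof -
    have "(N + 2) / (N - 2) = - (1 / a) * (- (a + 2))"
    proof -
      have a2: "N - 2 = 2 * a" by (simp add: a_def)
      then have "N = 2 * a + 2" by (simp only: diff_eq_eq)
      then have "N + 2 = 2 * (a + 2)" by (simp add: distrib_left)
      then have "(N + 2) / (N - 2) = (a + 2) / a"
        unfolding a2 by (simp only: mult_divide_mult_cancel_left[of 2] zero_neq_numeral not_False_eq_True)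
      then show ?thesis by (simp only: minus_mult_minus times_divide_eq_left mult_1)
    qed
    then show ?thesis by (simp only: v powr_powr)
  qed
  finally show "laplacian u y = N * (N - 2) * hyperbolic_radius u y powr (- (a + 2))" .
  have "u differentiable (at y)" using u y by (simp add: classical_solution_def numeral_2_eq_2)
  note du = has_derivative_grad[OF this]
  have e: "u y powr (- (1 / a) - 1) = hyperbolic_radius u y powr (a + 1)"
  proof -
    have "- (1 / a) - 1 = - (1 / a) * (a + 1)" using a by (simp add: distrib_left)
    then show ?thesis by (simp only: v powr_powr)
  qed
  show "(hyperbolic_radius u has_derivative
      (\<lambda>h. ((- (1 / a) * hyperbolic_radius u y powr (a + 1)) *\<^sub>R grad u y) \<bullet> h)) (at y)"
    using has_derivative_powr_const[OF du upos, of "- (1 / a)", unfolded e]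
    unfolding v[symmetric] by (simp add: mult_ac)
qed

text \<open>
  With \<open>V \<le> v\<close> the two radii, \<open>U - u = V\<^sup>-\<^sup>a - v\<^sup>-\<^sup>a\<close> and \<open>\<Delta>U - \<Delta>u\<close> is a multiple of
  \<open>V\<^sup>-\<^sup>a\<^sup>-\<^sup>2 - v\<^sup>-\<^sup>a\<^sup>-\<^sup>2\<close>. By the mean value theorem both are controlled by \<open>v - V \<le> E\<close>, with losses
  \<open>\<delta>\<^sup>-\<^sup>a\<^sup>-\<^sup>1\<close> and \<open>\<delta>\<^sup>-\<^sup>a\<^sup>-\<^sup>3\<close>. In the interior gradient estimate on a cube of size comparable to \<open>\<delta>\<close> the
  two contributions scale alike.
\<close>

lemma gradient_difference_of_classical_solutions:
  fixes u U :: "real^'n::finite \<Rightarrow> real"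
  defines "N \<equiv> real CARD('n)"
  defines "a \<equiv> (N - 2) / 2"
  assumes n: "CARD('n) \<ge> 3" and \<delta>: "\<delta> > 0" and E: "E > 0"
    and u: "classical_solution (ball x \<delta>) u" and U: "classical_solution (ball x \<delta>) U"
    and cmp: "\<And>y. norm (y - x) \<le> \<delta> / 2 \<Longrightarrow> \<delta> / 2 \<le> hyperbolic_radius U y \<and>
      hyperbolic_radius U y \<le> hyperbolic_radius u y \<and>
      hyperbolic_radius u y - hyperbolic_radius U y \<le> E"
  shows "norm (grad u x - grad U x) \<le>
    N * (4 * N\<^sup>2 * a + 4 * (N - 2) * (a + 2)) * ((\<delta> / 2) powr (- a) * E / \<delta>\<^sup>2)"
proof -
  have N: "N \<ge> 3" using n by (simp add: N_def)
  have a: "a > 0" using N by (simp add: a_def)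
  define q where "q = (\<delta> / 2) powr (- a)"
  have q: "q > 0" using \<delta> by (simp add: q_def)
  \<comment> \<open>Small enough for the cube of half side \<open>R\<close> to lie in the ball of radius \<open>\<delta> / 2\<close>.\<close>
  define R where "R = \<delta> / (2 * N)"
  have R: "R > 0" using \<delta> N by (simp add: R_def)
  have q1: "(\<delta> / 2) powr (- a - 1) = q * (2 / \<delta>)"
    using \<delta> by (simp add: q_def powr_diff)
  have q3: "(\<delta> / 2) powr (- (a + 2) - 1) = q * (8 / \<delta> ^ 3)"
  proof -
    have "- (a + 2) - 1 = - a - 3" by simp
    then have "(\<delta> / 2) powr (- (a + 2) - 1) = q / (\<delta> / 2) powr 3"
      by (simp only: q_def powr_diff)
    also have "(\<delta> / 2) powr 3 = (\<delta> / 2) ^ 3" using \<delta> powr_realpow[of "\<delta> / 2" 3] by simp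
    finally show ?thesis by (simp add: power_divide)
  qed
  define z where "z = (\<lambda>y. U y - u y)"
  define A where "A = a * (q * (2 / \<delta>)) * E"
  \<comment> \<open>The factor \<open>2\<close> makes the bound on the Laplacian strict.\<close>
  define B where "B = 2 * (N * (N - 2) * ((a + 2) * (q * (8 / \<delta> ^ 3)) * E))"
  have cube: "norm (y - x) \<le> \<delta> / 2" "y \<in> ball x \<delta>" if "\<And>i. \<bar>y $ i - x $ i\<bar> \<le> R" for y
  proof -
    have "norm (y - x) \<le> (\<Sum>i\<in>UNIV. \<bar>(y - x) $ i\<bar>)" by (rule norm_le_l1_cart)
    also have "\<dots> \<le> (\<Sum>i\<in>(UNIV::'n set). R)" by (rule sum_mono) (use that in simp)
    also have "\<dots> = \<delta> / 2" using N by (simp add: R_def N_def)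
    finally show "norm (y - x) \<le> \<delta> / 2" .
    then show "y \<in> ball x \<delta>" using \<delta> by (simp add: dist_norm norm_minus_commute)
  qed
  have diff_bounds: "\<bar>z y\<bar> \<le> A" "\<bar>laplacian U y - laplacian u y\<bar> < B"
    if "norm (y - x) \<le> \<delta> / 2" for y
  proof -
    have y: "y \<in> ball x \<delta>" using that \<delta> by (simp add: dist_norm norm_minus_commute)
    define V v where "V = hyperbolic_radius U y" and "v = hyperbolic_radius u y"
    have Vv: "\<delta> / 2 \<le> V" "V \<le> v" "v - V \<le> E" using cmp[OF that] by (auto simp: V_def v_def)
    have m: "0 < \<delta> / 2" using \<delta> by simp
    note ru = classical_solution_via_radius[OF n u y, folded N_def, folded a_def, folded v_def]
    note rU = classical_solution_via_radius[OF n U y, folded N_def, folded a_def, folded V_def]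
    have z: "z y = V powr (- a) - v powr (- a)" by (simp only: z_def ru(2) rU(2))
    have "z y \<le> a * (\<delta> / 2) powr (- a - 1) * (v - V)"
      unfolding z by (rule powr_minus_diff_bounds(2)[OF m Vv(1,2) a])
    also have "\<dots> \<le> a * (\<delta> / 2) powr (- a - 1) * E"
      using Vv(3) a by (intro mult_left_mono) auto
    finally have "z y \<le> A" by (simp only: A_def q1)
    moreover have "0 \<le> z y" unfolding z by (rule powr_minus_diff_bounds(1)[OF m Vv(1,2) a])
    ultimately show "\<bar>z y\<bar> \<le> A" by simp
    define L where "L = V powr (- (a + 2)) - v powr (- (a + 2))"
    have a2: "a + 2 > 0" using a by simp
    have "L \<le> (a + 2) * (\<delta> / 2) powr (- (a + 2) - 1) * (v - V)"
      unfolding L_def by (rule powr_minus_diff_bounds(2)[OF m Vv(1,2) a2])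
    also have "\<dots> \<le> (a + 2) * (\<delta> / 2) powr (- (a + 2) - 1) * E"
      using Vv(3) a by (intro mult_left_mono) auto
    finally have L: "L \<le> (a + 2) * (q * (8 / \<delta> ^ 3)) * E" by (simp only: q3)
    have L0: "0 \<le> L" unfolding L_def by (rule powr_minus_diff_bounds(1)[OF m Vv(1,2) a2])
    have NN: "N * (N - 2) > 0" using N by simp
    have lap: "laplacian U y - laplacian u y = N * (N - 2) * L"
      by (simp only: ru(3) rU(3) L_def right_diff_distrib)
    have Bpos: "B > 0" unfolding B_def using N a q \<delta> E by simp
    have "N * (N - 2) * L \<le> N * (N - 2) * ((a + 2) * (q * (8 / \<delta> ^ 3)) * E)"
      using NN by (intro mult_left_mono[OF L]) simp
    also have "\<dots> = B / 2" by (simp add: B_def)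
    finally have "N * (N - 2) * L \<le> B / 2" .
    moreover have "0 \<le> N * (N - 2) * L" using L0 NN by simp
    ultimately show "\<bar>laplacian U y - laplacian u y\<bar> < B" using Bpos unfolding lap by linarith
  qed
  have lp: "line_partials (ball x \<delta>) z
      (\<lambda>i y. partial_deriv i U y - partial_deriv i u y)
      (\<lambda>i y. partial_deriv i (partial_deriv i U) y - partial_deriv i (partial_deriv i u) y)"
    unfolding z_def by (intro line_partials_diff line_partials_Ck_2)
      (use u U in \<open>auto simp: classical_solution_def\<close>)
  have cont: "continuous_on (ball x \<delta>) z"
    unfolding z_def using u U
    by (intro continuous_on_diff continuous_at_imp_continuous_on ballI differentiable_imp_continuous_within)
      (auto simp: classical_solution_def numeral_2_eq_2)
  have comp: "\<bar>(grad u x - grad U x) $ k\<bar> \<le> N * A / R + B * R / 2" for k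
  proof -
    have "\<bar>partial_deriv k U x - partial_deriv k u x\<bar> \<le> N * A / R + B * R / 2"
      unfolding N_def
    proof (rule gradient_estimate[OF R lp cont])
      fix y :: "real^'n" assume y: "\<And>i. \<bar>y $ i - x $ i\<bar> \<le> R"
      show "y \<in> ball x \<delta>" by (rule cube(2)[OF y])
      show "\<bar>z y\<bar> \<le> A" by (rule diff_bounds(1)[OF cube(1)[OF y]])
      show "\<bar>\<Sum>i\<in>UNIV. partial_deriv i (partial_deriv i U) y - partial_deriv i (partial_deriv i u) y\<bar> < B"
        using diff_bounds(2)[OF cube(1)[OF y]] by (simp only: laplacian_def sum_subtractf)
    qed
    then show ?thesis by (simp add: grad_def abs_minus_commute)
  qed
  have AR: "N * A / R = 4 * N\<^sup>2 * a * (q * E / \<delta>\<^sup>2)"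
    using \<delta> N by (simp add: A_def R_def power2_eq_square)
  have "B * R / 2 = 4 * (N - 2) * (a + 2) * (q * E / \<delta>\<^sup>2)"
    using \<delta> N by (simp add: B_def R_def power2_eq_square power3_eq_cube)
  then have "N * A / R + B * R / 2 = (4 * N\<^sup>2 * a + 4 * (N - 2) * (a + 2)) * (q * E / \<delta>\<^sup>2)"
    unfolding AR by (simp only: distrib_right)
  note comp = comp[unfolded this]
  have "norm (grad u x - grad U x) \<le> (\<Sum>k\<in>UNIV. \<bar>(grad u x - grad U x) $ k\<bar>)"
    by (rule norm_le_l1_cart)
  also have "\<dots> \<le> (\<Sum>k\<in>(UNIV::'n set). (4 * N\<^sup>2 * a + 4 * (N - 2) * (a + 2)) * (q * E / \<delta>\<^sup>2))"
    by (rule sum_mono) (rule comp)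
  finally show ?thesis by (simp add: N_def q_def mult.assoc)
qed

lemma model_radius_gap:
  fixes p \<nu> y :: "real^'n::finite"
  assumes "norm \<nu> = 1" "s > 0"
  shows "model_radius (- 1) s (p - s *\<^sub>R \<nu>) y - model_radius 1 s (p + s *\<^sub>R \<nu>) y = 2 * (norm (y - p))\<^sup>2 / s"
proof -
  define z where "z = y - p"
  have nn: "\<nu> \<bullet> \<nu> = 1" using assms by (simp add: dot_square_norm)
  have 1: "(norm (y - (p - s *\<^sub>R \<nu>)))\<^sup>2 = (norm z)\<^sup>2 + 2 * s * (\<nu> \<bullet> z) + s\<^sup>2"
  proof -
    have eq: "y - (p - s *\<^sub>R \<nu>) = z + s *\<^sub>R \<nu>" by (simp add: z_def)
    show ?thesis
      unfolding eq power2_norm_eq_inner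
      by (simp add: inner_add_left inner_add_right nn inner_commute[of z \<nu>] power2_eq_square distrib_left)
  qed
  have 2: "(norm (y - (p + s *\<^sub>R \<nu>)))\<^sup>2 = (norm z)\<^sup>2 - 2 * s * (\<nu> \<bullet> z) + s\<^sup>2"
  proof -
    have eq: "y - (p + s *\<^sub>R \<nu>) = z - s *\<^sub>R \<nu>" by (simp add: z_def)
    show ?thesis
      unfolding eq power2_norm_eq_inner
      by (simp add: inner_diff_left inner_diff_right nn inner_commute[of z \<nu>] power2_eq_square right_diff_distrib)
  qed
  show ?thesis
    unfolding model_radius_def 1 2 z_def[symmetric] diff_divide_distrib[symmetric]
    by (simp add: algebra_simps)
qed

text \<open>
  The radius \<open>v\<close> of \<open>u\<close> is enclosed by the two model radii at the foot point \<open>p\<close>, which differ by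
  \<open>O(\<delta>\<^sup>2)\<close> near \<open>x\<close>. Let \<open>V\<close> and \<open>U\<close> be the interior model radius and solution. As
  \<open>\<nabla>v = k(v) \<nabla>u\<close> with \<open>k(t) = - t\<^sup>a\<^sup>+\<^sup>1 / a\<close>, and likewise for \<open>V\<close>, one has
  \<open>\<nabla>v - 2 \<nu> = k(v) (\<nabla>u - \<nabla>U) + (k(v) - k(V)) \<nabla>U + (\<nabla>V - 2 \<nu>)\<close>. The three terms are \<open>O(\<delta>)\<close> by the
  gradient estimate, by \<open>v - V = O(\<delta>\<^sup>2)\<close>, and by the explicit form of \<open>V\<close>.
\<close>

lemma hyperbolic_radius_collar_estimates:
  fixes \<Omega> :: "(real^'n::finite) set"
  defines "N \<equiv> real CARD('n)"
  defines "a \<equiv> (N - 2) / 2"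
  assumes n: "CARD('n) \<ge> 3" and u: "maximal_solution \<Omega> u" and "open \<Omega>"
    and tb: "tangent_balls \<Omega> s p \<nu>" and \<delta>: "0 < \<delta>" "\<delta> < s / 2"
    and x: "x \<in> \<Omega>" "x = p + \<delta> *\<^sub>R \<nu>"
  shows "\<delta> \<le> hyperbolic_radius u x" and "\<bar>hyperbolic_radius u x - 2 * \<delta>\<bar> \<le> \<delta>\<^sup>2 / s"
    and "norm (grad (hyperbolic_radius u) x - 2 *\<^sub>R \<nu>) \<le>
      (6 powr (a + 1) / a * N * (4 * N\<^sup>2 * a + 4 * (N - 2) * (a + 2)) * 5 / 2
        + 4 * (a + 1) * 3 powr a + 2) / s * \<delta>"
proof -
  have N: "N \<ge> 3" using n by (simp add: N_def)
  have a: "a > 0" using N by (simp add: a_def)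
  have s: "s > 0" using \<delta> by linarith
  define ci where "ci = p + s *\<^sub>R \<nu>"
  define ce where "ce = p - s *\<^sub>R \<nu>"
  have n1: "norm \<nu> = 1" and int: "ball ci s \<subseteq> \<Omega>" and ext: "ball ce s \<inter> \<Omega> = {}"
    using tb by (auto simp: tangent_balls_def ci_def ce_def)
  define v where "v = hyperbolic_radius u"
  define V where "V = model_radius 1 s ci"
  define U where "U = model_solution 1 s ci"
  have clu: "classical_solution \<Omega> u" using u by (simp add: maximal_solution_def)
  have xci: "x - ci = - ((s - \<delta>) *\<^sub>R \<nu>)" unfolding x(2) ci_def by (simp add: algebra_simps)
  have nxci: "norm (x - ci) = s - \<delta>"
    unfolding xci norm_minus_cancel norm_scaleR n1 using \<delta> s by simp
  have nxp: "norm (x - p) = \<delta>" unfolding x(2) using n1 \<delta> by simp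
  have sub: "ball x \<delta> \<subseteq> ball ci s"
  proof
    fix y assume "y \<in> ball x \<delta>"
    then show "y \<in> ball ci s"
      using nxci norm_triangle_ineq[of "y - x" "x - ci"] by (simp add: dist_norm norm_minus_commute)
  qed
  have Vpos: "V y > 0" if "y \<in> ball ci s" for y
    using that s by (simp add: V_def model_radius_def dist_norm norm_minus_commute power_strict_mono)
  have clU: "classical_solution (ball ci s) U"
    unfolding U_def by (rule model_solution[OF s _ open_ball]) (use Vpos in \<open>simp_all add: V_def\<close>)
  have hU: "hyperbolic_radius U y = V y" if "y \<in> ball ci s" for y
    using hyperbolic_radius_model_solution[OF n Vpos[OF that, unfolded V_def]] by (simp add: U_def V_def)
  have lower: "V y \<le> v y" if "y \<in> ball ci s" for y
    unfolding V_def v_def by (rule hyperbolic_radius_ge_interior[OF n clu s int that])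
  have upper: "v y \<le> V y + 2 * (norm (y - p))\<^sup>2 / s" if "y \<in> \<Omega>" for y
    using hyperbolic_radius_le_exterior[OF n u \<open>open \<Omega>\<close> s
        boundary_dist_le_exterior(1)[OF \<open>open \<Omega>\<close> s ext] that]
      model_radius_gap[OF n1 s, of p y] by (simp add: V_def v_def ci_def ce_def)
  have "x \<in> ball x \<delta>" using \<delta> by simp
  then have xb: "x \<in> ball ci s" by (rule subsetD[OF sub])
  have Vx: "V x = 2 * \<delta> - \<delta>\<^sup>2 / s"
    unfolding V_def model_radius_def nxci using s
    by (simp add: power2_eq_square field_simps)
  have dds: "\<delta>\<^sup>2 / s \<le> \<delta>"
    using \<delta> s by (simp add: power2_eq_square divide_le_eq)
  have vx: "V x \<le> v x" "v x \<le> V x + 2 * \<delta>\<^sup>2 / s"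
    using lower[OF xb] upper[OF x(1)] by (simp_all add: nxp)
  show "\<delta> \<le> hyperbolic_radius u x" using vx Vx dds by (simp add: v_def)
  show "\<bar>hyperbolic_radius u x - 2 * \<delta>\<bar> \<le> \<delta>\<^sup>2 / s" using vx Vx by (simp add: v_def abs_le_iff)
  have Vx1: "\<delta> \<le> V x" and vx3: "v x \<le> 3 * \<delta>" using vx Vx dds by linarith+
  have gapx: "v x - V x \<le> 2 * \<delta>\<^sup>2 / s" using vx by simp
  define Q where "Q = N * (4 * N\<^sup>2 * a + 4 * (N - 2) * (a + 2))"
  have Q: "Q \<ge> 0" unfolding Q_def using N a by simp
  have "norm (grad u x - grad U x) \<le> Q * ((\<delta> / 2) powr (- a) * (5 * \<delta>\<^sup>2 / s) / \<delta>\<^sup>2)"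
    unfolding Q_def a_def N_def
  proof (rule gradient_difference_of_classical_solutions[OF n \<delta>(1)])
    show "5 * \<delta>\<^sup>2 / s > 0" using \<delta> s by simp
    show "classical_solution (ball x \<delta>) u"
      by (rule classical_solution_subset[OF clu order_trans[OF sub int]])
    show "classical_solution (ball x \<delta>) U"
      by (rule classical_solution_subset[OF clU sub])
    fix y assume y: "norm (y - x) \<le> \<delta> / 2"
    have yb: "y \<in> ball ci s"
      using y \<delta> sub by (intro subsetD[OF sub]) (simp add: dist_norm norm_minus_commute)
    have "norm (y - ci) \<le> s - \<delta> / 2"
      using norm_triangle_ineq[of "y - x" "x - ci"] y nxci by simp
    then have "(norm (y - ci))\<^sup>2 \<le> (s - \<delta> / 2)\<^sup>2" by (intro power_mono) auto
    then have "(s\<^sup>2 - (s - \<delta> / 2)\<^sup>2) / s \<le> V y"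
      unfolding V_def model_radius_def using s by (simp add: divide_right_mono)
    moreover have "(s\<^sup>2 - (s - \<delta> / 2)\<^sup>2) / s = \<delta> - \<delta>\<^sup>2 / s / 4"
      using s by (simp add: power2_eq_square field_simps)
    ultimately have "\<delta> - \<delta>\<^sup>2 / s / 4 \<le> V y" by (simp only:)
    moreover have "\<delta> / 2 \<le> \<delta> - e / 4" if "e \<le> \<delta>" for e using that \<delta>(1) by simp
    ultimately have Vy: "\<delta> / 2 \<le> V y" using dds order_trans by blast
    have "norm (y - p) \<le> 3 / 2 * \<delta>"
      using norm_triangle_ineq[of "y - x" "x - p"] y nxp by simp
    then have "(norm (y - p))\<^sup>2 \<le> (3 / 2 * \<delta>)\<^sup>2" by (intro power_mono) auto
    also have "\<dots> \<le> 5 / 2 * \<delta>\<^sup>2" by (simp add: power2_eq_square)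
    finally have "2 * (norm (y - p))\<^sup>2 / s \<le> 5 * \<delta>\<^sup>2 / s"
      using s by (intro divide_right_mono) auto
    moreover have "y \<in> \<Omega>" using yb int by blast
    ultimately have "v y - V y \<le> 5 * \<delta>\<^sup>2 / s" using upper[of y] by linarith
    then show "\<delta> / 2 \<le> hyperbolic_radius U y \<and> hyperbolic_radius U y \<le> hyperbolic_radius u y \<and>
      hyperbolic_radius u y - hyperbolic_radius U y \<le> 5 * \<delta>\<^sup>2 / s"
      using Vy lower[OF yb] hU[OF yb] by (simp add: v_def)
  qed
  also have "\<dots> = Q * 5 / s * (\<delta> / 2) powr (- a)" using \<delta> by simp
  finally have gU: "norm (grad u x - grad U x) \<le> Q * 5 / s * (\<delta> / 2) powr (- a)" .
  define k where "k = (\<lambda>t. - (1 / a) * t powr (a + 1))"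
  have gv: "grad v x = k (v x) *\<^sub>R grad u x"
    unfolding v_def k_def a_def N_def by (rule grad_eq[OF classical_solution_via_radius(4)[OF n clu x(1)]])
  have gV: "grad V x = k (V x) *\<^sub>R grad U x"
  proof (rule grad_eq, rule has_derivative_transform_within_open[OF _ open_ball xb])
    show "(hyperbolic_radius U has_derivative (\<lambda>h. (k (V x) *\<^sub>R grad U x) \<bullet> h)) (at x)"
      using classical_solution_via_radius(4)[OF n clU xb]
      unfolding hU[OF xb] k_def a_def N_def .
  qed (rule hU)
  have gV': "grad V x = (2 * (s - \<delta>) / s) *\<^sub>R \<nu>"
    using grad_eq[OF has_derivative_model_radius[of 1 s ci x]] by (simp add: V_def xci)
  have t1: "norm (k (v x) *\<^sub>R (grad u x - grad U x)) \<le> 6 powr (a + 1) / a * Q * 5 / 2 / s * \<delta>"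
  proof -
    have "v x powr (a + 1) \<le> (6 * (\<delta> / 2)) powr (a + 1)"
      using vx3 Vx1 vx \<delta> a by (intro powr_mono2) auto
    also have "\<dots> = 6 powr (a + 1) * (\<delta> / 2) powr (a + 1)" by (rule powr_mult)
    finally have v1: "v x powr (a + 1) \<le> 6 powr (a + 1) * (\<delta> / 2) powr (a + 1)" .
    have "norm (k (v x) *\<^sub>R (grad u x - grad U x)) = 1 / a * v x powr (a + 1) * norm (grad u x - grad U x)"
      using a by (simp add: k_def abs_mult)
    also have "\<dots> \<le> 1 / a * (6 powr (a + 1) * (\<delta> / 2) powr (a + 1)) * (Q * 5 / s * (\<delta> / 2) powr (- a))"
      using v1 gU a by (intro mult_mono mult_left_mono) auto
    also have "\<dots> = 1 / a * 6 powr (a + 1) * (Q * 5 / s) * ((\<delta> / 2) powr (a + 1) * (\<delta> / 2) powr (- a))"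
      by (simp only: mult_ac)
    also have "(\<delta> / 2) powr (a + 1) * (\<delta> / 2) powr (- a) = \<delta> / 2"
      using \<delta> by (simp flip: powr_add)
    finally show ?thesis by (simp add: mult_ac)
  qed
  have t2: "norm ((k (v x) - k (V x)) *\<^sub>R grad U x) \<le> 4 * (a + 1) * 3 powr a / s * \<delta>"
  proof -
    define e where "e = (v x powr (a + 1) - V x powr (a + 1)) / V x powr (a + 1)"
    have Vx0: "V x > 0" using Vx1 \<delta> by linarith
    have "e * k (V x) = - (1 / a) * (e * V x powr (a + 1))" by (simp add: k_def)
    also have "e * V x powr (a + 1) = v x powr (a + 1) - V x powr (a + 1)"
      using Vx0 by (simp add: e_def)
    finally have "k (v x) - k (V x) = e * k (V x)" by (simp only: k_def right_diff_distrib)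
    then have "(k (v x) - k (V x)) *\<^sub>R grad U x = e *\<^sub>R (k (V x) *\<^sub>R grad U x)" by simp
    then have eq: "norm ((k (v x) - k (V x)) *\<^sub>R grad U x) = \<bar>e\<bar> * norm (grad V x)"
      by (simp only: gV norm_scaleR)
    have e0: "e \<ge> 0"
      unfolding e_def using vx(1) Vx0 a by (simp add: powr_mono2)
    have "v x powr (a + 1) - V x powr (a + 1) \<le> (a + 1) * v x powr (a + 1 - 1) * (v x - V x)"
      by (rule powr_diff_le[OF Vx0 vx(1)]) (use a in simp)
    also have "\<dots> \<le> (a + 1) * (3 * \<delta>) powr a * (2 * \<delta>\<^sup>2 / s)"
      using vx3 vx Vx0 gapx a by (intro mult_mono mult_left_mono) (auto intro!: powr_mono2)
    also have "\<dots> = (2 * (a + 1) * 3 powr a / s * \<delta>) * (\<delta> powr a * \<delta>)"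
      using \<delta> by (simp add: powr_mult power2_eq_square)
    also have "\<delta> powr a * \<delta> = \<delta> powr (a + 1)" using \<delta> by (simp add: powr_add)
    also have "(2 * (a + 1) * 3 powr a / s * \<delta>) * \<delta> powr (a + 1) \<le> (2 * (a + 1) * 3 powr a / s * \<delta>) * V x powr (a + 1)"
      using Vx1 \<delta> a s by (intro mult_left_mono powr_mono2) auto
    finally have "e \<le> 2 * (a + 1) * 3 powr a / s * \<delta>"
      unfolding e_def using Vx0 by (simp add: pos_divide_le_eq)
    moreover have "norm (grad V x) \<le> 2"
      unfolding gV' norm_scaleR n1 using \<delta> s by (simp add: divide_le_eq)
    ultimately have "\<bar>e\<bar> * norm (grad V x) \<le> (2 * (a + 1) * 3 powr a / s * \<delta>) * 2"
      using e0 by (intro mult_mono) auto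
    also have "\<dots> = 4 * (a + 1) * 3 powr a / s * \<delta>" by simp
    finally show ?thesis unfolding eq .
  qed
  have t3: "norm (grad V x - 2 *\<^sub>R \<nu>) \<le> 2 / s * \<delta>"
  proof -
    have "grad V x - 2 *\<^sub>R \<nu> = (2 * (s - \<delta>) / s - 2) *\<^sub>R \<nu>" by (simp only: gV' scaleR_diff_left)
    moreover have "2 * (s - \<delta>) / s - 2 = - (2 / s * \<delta>)" using s by (simp add: field_simps)
    ultimately show ?thesis using n1 \<delta> s by simp
  qed
  have "grad v x - 2 *\<^sub>R \<nu> = k (v x) *\<^sub>R (grad u x - grad U x) + (k (v x) - k (V x)) *\<^sub>R grad U x
      + (grad V x - 2 *\<^sub>R \<nu>)"
    unfolding gv gV by (simp add: scaleR_diff_left scaleR_diff_right)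
  moreover have "norm (b + c + d) \<le> norm b + norm c + norm d" for b c d :: "real^'n"
    using norm_triangle_ineq[of "b + c" d] norm_triangle_ineq[of b c] by linarith
  ultimately have "norm (grad v x - 2 *\<^sub>R \<nu>) \<le> norm (k (v x) *\<^sub>R (grad u x - grad U x))
      + norm ((k (v x) - k (V x)) *\<^sub>R grad U x) + norm (grad V x - 2 *\<^sub>R \<nu>)"
    by (simp only:)
  also have "\<dots> \<le> 6 powr (a + 1) / a * Q * 5 / 2 / s * \<delta> + 4 * (a + 1) * 3 powr a / s * \<delta> + 2 / s * \<delta>"
    by (intro add_mono t1 t2 t3)
  also have "\<dots> = (6 powr (a + 1) / a * Q * 5 / 2 + 4 * (a + 1) * 3 powr a + 2) / s * \<delta>"
    by (simp only: add_divide_distrib distrib_right)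
  finally show "norm (grad (hyperbolic_radius u) x - 2 *\<^sub>R \<nu>) \<le>
      (6 powr (a + 1) / a * N * (4 * N\<^sup>2 * a + 4 * (N - 2) * (a + 2)) * 5 / 2
        + 4 * (a + 1) * 3 powr a + 2) / s * \<delta>"
    by (simp only: v_def Q_def mult.assoc)
qed

theorem theorem1p3:
  fixes \<Omega> :: "(real^'n::finite) set"
    and \<alpha> :: real
    and u v d w :: "real^'n \<Rightarrow> real"
  assumes "CARD('n) \<ge> 3"
    and "0 < \<alpha>" and "\<alpha> < 1"
    and "bounded_Ck_holder_domain 2 \<alpha> \<Omega>"
    and "maximal_solution \<Omega> u"
    and "v = hyperbolic_radius u"
    and "d = boundary_dist \<Omega>"
    and "w = (\<lambda>x. (v x - 2 * d x) / (d x)\<^sup>2)"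
  shows "bounded_near_boundary \<Omega> (\<lambda>x. d x *\<^sub>R grad w x) \<and>
         bounded_near_boundary \<Omega> (\<lambda>x. M_op d w w x / d x)"
proof -
  note n = assms(1) and u = assms(5) and v_eq = assms(6) and d_eq = assms(7) and w_eq = assms(8)
  define N where "N = real CARD('n)"
  have N: "N \<ge> 3" using n by (simp add: N_def)
  have "open \<Omega>" using assms(4) by (simp add: bounded_Ck_holder_domain_def)
  obtain s where s: "s > 0" and nf: "\<And>p. p \<in> frontier \<Omega> \<Longrightarrow> normal_field_at \<Omega> s p"
    using uniform_normal_field[OF assms(4,2)] by metis
  define a where "a = (N - 2) / 2"
  define C where "C = (6 powr (a + 1) / a * N * (4 * N\<^sup>2 * a + 4 * (N - 2) * (a + 2)) * 5 / 2
        + 4 * (a + 1) * 3 powr a + 2) / s"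
  define C1 where "C1 = C + 2 / s"
  define C2 where "C2 = N / 2 * (2 * (1 / s) * C1 + C1 * C1) + 2 * (1 / s) * (2 * N / s)"
  have main: "norm (d x *\<^sub>R grad w x) \<le> C1 \<and> norm (M_op d w w x / d x) \<le> C2"
    if x: "x \<in> \<Omega>" "0 < d x" "d x < s / 2" for x
  proof -
    define \<delta> where "\<delta> = d x"
    have \<delta>: "0 < \<delta>" "\<delta> < s / 2" using x by (simp_all add: \<delta>_def)
    obtain p \<nu> where tb: "tangent_balls \<Omega> s p \<nu>" and xp: "x = p + \<delta> *\<^sub>R \<nu>"
      and gd: "grad d x = \<nu>" and dd: "(d has_derivative (\<lambda>h. \<nu> \<bullet> h)) (at x)"
      by (rule has_derivative_boundary_dist_in_collar[OF \<open>open \<Omega>\<close> s nf x(1)])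
        (use x s in \<open>auto simp: d_eq \<delta>_def\<close>)
    have n1: "norm \<nu> = 1" using tb by (simp add: tangent_balls_def)
    note est = hyperbolic_radius_collar_estimates[OF n u \<open>open \<Omega>\<close> tb \<delta> x(1) xp,
        folded v_eq N_def, folded a_def, folded C_def]
    have "classical_solution \<Omega> u" using u by (simp add: maximal_solution_def)
    from classical_solution_via_radius(4)[OF n this x(1)]
    have "v differentiable (at x)" unfolding v_eq differentiable_def by blast
    then have dv: "(v has_derivative (\<lambda>h. grad v x \<bullet> h)) (at x)" by (rule has_derivative_grad)
    define W where "W = (1 / \<delta>\<^sup>2) *\<^sub>R (grad v x - 2 *\<^sub>R \<nu>) - (2 * (v x - 2 * \<delta>) / \<delta> ^ 3) *\<^sub>R \<nu>"
    have "(w has_derivative (\<lambda>h. W \<bullet> h)) (at x)"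
    proof -
      have num: "((\<lambda>y. v y - 2 * d y) has_derivative (\<lambda>h. grad v x \<bullet> h - 2 * (\<nu> \<bullet> h))) (at x)"
        by (intro has_derivative_diff dv has_derivative_mult_right dd)
      have den: "((\<lambda>y. d y * d y) has_derivative (\<lambda>h. d x * (\<nu> \<bullet> h) + (\<nu> \<bullet> h) * d x)) (at x)"
        by (rule has_derivative_mult[OF dd dd])
      have nz: "d x * d x \<noteq> 0" using x(2) by simp
      have "((\<lambda>y. (v y - 2 * d y) / (d y * d y)) has_derivative
          (\<lambda>h. ((grad v x \<bullet> h - 2 * (\<nu> \<bullet> h)) * (d x * d x)
            - (v x - 2 * d x) * (d x * (\<nu> \<bullet> h) + (\<nu> \<bullet> h) * d x)) / ((d x * d x) * (d x * d x)))) (at x)"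
        by (rule has_derivative_divide'[OF num den nz])
      moreover have "((grad v x \<bullet> h - 2 * (\<nu> \<bullet> h)) * (d x * d x)
            - (v x - 2 * d x) * (d x * (\<nu> \<bullet> h) + (\<nu> \<bullet> h) * d x)) / ((d x * d x) * (d x * d x)) = W \<bullet> h" for h
      proof -
        have Wh: "W \<bullet> h = (1 / \<delta>\<^sup>2) * (grad v x \<bullet> h - 2 * (\<nu> \<bullet> h)) - (2 * (v x - 2 * \<delta>) / \<delta> ^ 3) * (\<nu> \<bullet> h)"
          by (simp only: W_def inner_diff_left inner_scaleR_left)
        show ?thesis
          unfolding \<delta>_def[symmetric] Wh using \<delta>(1)
          by (simp add: power2_eq_square power3_eq_cube field_simps)
      qed
      ultimately show ?thesis by (simp add: w_eq power2_eq_square)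
    qed
    then have gw: "grad w x = W" by (rule grad_eq)
    have wx: "w x = (v x - 2 * \<delta>) / \<delta>\<^sup>2" by (simp add: w_eq \<delta>_def)
    have w_le: "\<bar>w x\<bar> \<le> 1 / s"
      using est(2) \<delta>(1) by (simp add: wx abs_divide pos_divide_le_eq)
    have dW: "\<delta> *\<^sub>R W = (1 / \<delta>) *\<^sub>R (grad v x - 2 *\<^sub>R \<nu>) - (2 * w x) *\<^sub>R \<nu>"
      using \<delta>(1) by (simp add: W_def wx scaleR_diff_right power2_eq_square power3_eq_cube)
    have W_le: "norm (\<delta> *\<^sub>R W) \<le> C1"
    proof -
      have "norm (\<delta> *\<^sub>R W) \<le> norm ((1 / \<delta>) *\<^sub>R (grad v x - 2 *\<^sub>R \<nu>)) + norm ((2 * w x) *\<^sub>R \<nu>)"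
        unfolding dW by (rule norm_triangle_ineq4)
      also have "norm ((1 / \<delta>) *\<^sub>R (grad v x - 2 *\<^sub>R \<nu>)) \<le> C"
        using est(3) \<delta>(1) by (simp add: divide_le_eq)
      also have "norm ((2 * w x) *\<^sub>R \<nu>) \<le> 2 / s" using w_le n1 by (simp add: abs_mult)
      finally show ?thesis by (simp add: C1_def)
    qed
    have C1: "C1 \<ge> 0" using W_le norm_ge_zero order_trans by blast
    have den: "2 + \<delta> * w x = v x / \<delta>" using \<delta>(1) by (simp add: wx power2_eq_square field_simps)
    have den1: "v x / \<delta> \<ge> 1" using est(1) \<delta>(1) by (simp add: le_divide_eq)
    define Y where "Y = 2 * w x * (\<nu> \<bullet> (\<delta> *\<^sub>R W)) + (\<delta> *\<^sub>R W) \<bullet> (\<delta> *\<^sub>R W)"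
    have "M_op d w w x / d x = N * \<delta>\<^sup>2 / (2 * (v x / \<delta>)) * (2 * w x * (\<nu> \<bullet> W) + \<delta> * (W \<bullet> W)) / \<delta>
        - 2 * \<delta> * w x * laplacian d x / \<delta>"
      by (simp add: M_op_def gd gw N_def diff_divide_distrib flip: \<delta>_def den)
    also have "\<dots> = N / (2 * (v x / \<delta>)) * (\<delta>\<^sup>2 * (2 * w x * (\<nu> \<bullet> W) + \<delta> * (W \<bullet> W)) / \<delta>)
        - 2 * w x * laplacian d x"
      using \<delta>(1) by simp
    also have "\<delta>\<^sup>2 * (2 * w x * (\<nu> \<bullet> W) + \<delta> * (W \<bullet> W)) / \<delta> = Y"
      using \<delta>(1) by (simp add: Y_def power2_eq_square distrib_left add_divide_distrib)
    finally have M: "M_op d w w x / d x = N / (2 * (v x / \<delta>)) * Y - 2 * w x * laplacian d x" .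
    have "\<bar>\<nu> \<bullet> (\<delta> *\<^sub>R W)\<bar> \<le> C1"
      using Cauchy_Schwarz_ineq2[of \<nu> "\<delta> *\<^sub>R W"] n1 W_le by simp
    then have "\<bar>w x\<bar> * \<bar>\<nu> \<bullet> (\<delta> *\<^sub>R W)\<bar> \<le> 1 / s * C1"
      using w_le s by (intro mult_mono) auto
    moreover have "(\<delta> *\<^sub>R W) \<bullet> (\<delta> *\<^sub>R W) \<le> C1 * C1"
      using mult_mono[OF W_le W_le C1 norm_ge_zero] by (simp only: dot_square_norm power2_eq_square)
    ultimately have Y: "\<bar>Y\<bar> \<le> 2 * (1 / s) * C1 + C1 * C1"
      using abs_triangle_ineq[of "2 * w x * (\<nu> \<bullet> (\<delta> *\<^sub>R W))" "(\<delta> *\<^sub>R W) \<bullet> (\<delta> *\<^sub>R W)"]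
      unfolding Y_def abs_mult[of "2 * w x"] abs_mult[of 2 "w x"] abs_of_nonneg[OF inner_ge_zero]
      by simp
    have "\<bar>N / (2 * (v x / \<delta>)) * Y\<bar> \<le> N / 2 * (2 * (1 / s) * C1 + C1 * C1)"
    proof -
      have "N / (2 * (v x / \<delta>)) \<le> N / 2"
        using den1 N by (intro divide_left_mono) auto
      moreover have "0 \<le> N / (2 * (v x / \<delta>))"
        using den1 N by (intro divide_nonneg_nonneg[of N] mult_nonneg_nonneg[of 2]) linarith+
      ultimately show ?thesis
        unfolding abs_mult using Y N by (intro mult_mono) auto
    qed
    moreover have "\<bar>2 * w x * laplacian d x\<bar> \<le> 2 * (1 / s) * (2 * N / s)"
    proof -
      have "\<bar>laplacian d x\<bar> \<le> 2 * N / s"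
        unfolding d_eq N_def
        by (rule laplacian_boundary_dist_bound[OF \<open>open \<Omega>\<close> s nf x(1)]) (use x in \<open>simp_all add: d_eq\<close>)
      then show ?thesis
        unfolding abs_mult using w_le s by (intro mult_mono) auto
    qed
    ultimately have "\<bar>M_op d w w x / d x\<bar> \<le> C2"
      unfolding M C2_def
      using abs_triangle_ineq4[of "N / (2 * (v x / \<delta>)) * Y" "2 * w x * laplacian d x"] by linarith
    then show ?thesis using W_le by (simp add: gw flip: \<delta>_def)
  qed
  have "s / 2 > 0" using s by simp
  then show ?thesis
    unfolding bounded_near_boundary_def bounded_iff d_eq[symmetric] using main by blast
qed

end
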